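(* Let $\alpha\in\mathbb{R}\setminus\mathbb{Q}$. Then $(\mathbb{Z};+,C_\alpha)$ is not a reduct of $(\mathbb{Z};+,<)$, and for every prime $p$, $(\mathbb{Z};+,C_\alpha)$ is not a reduct of $(\mathbb{Z};+,\prec_p)$.
   Context: Let $C$ be the ternary relation on $\mathbb{R}/\mathbb{Z}$ (the positively oriented circle) such that for $a,b,c\in[0,1)$, $C(a+\mathbb{Z},b+\mathbb{Z},c+\mathbb{Z})$ holds iff $a<b<c$ or $b<c<a$ or $c<a<b$. For $\alpha\in\mathbb{R}\setminus\mathbb{Q}$, $C_\alpha$ is the ternary relation (an additive cyclic order) on $\mathbb{Z}$ given by: $C_\alpha(j,k,l)$ iff $C(\alpha j+\mathbb{Z},\alpha k+\mathbb{Z},\alpha l+\mathbb{Z})$. For a prime $p$, $\prec_p$ is the partial order on $\mathbb{Z}$ with $k\prec_p l$ iff $v_p(k)<v_p(l)$, where $v_p$ is the $p$-adic valuation on $\mathbb{Z}$ (with $v_p(0)=\infty$). The operation $+$ and the order $<$ on $\mathbb{Z}$ are the usual ones. "Definable" means first-order definable, parameters allowed. If $\mathscr{M}_1$ and $\mathscr{M}_2$ are structures with the same underlying set $M$, $\mathscr{M}_1$ is a reduct of $\mathscr{M}_2$ if every $\mathscr{M}_1$-definable set (subset of some $M^k$) is also definable in $\mathscr{M}_2$. *)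

theory Defs
  imports Complex_Main "HOL-Library.Set_Algebras" "HOL-Library.Extended_Nat"
    "HOL-Computational_Algebra.Primes"
begin

text \<open>
  One-sorted first-order structures whose underlying set is a whole type \<open>'a\<close>. The interpretation
  of a symbol is only ever applied to lists whose length is the arity of the symbol
  (see \<open>wf_fm\<close> below).
\<close>

record ('f, 'r, 'a) fo_struct =
  fun_arity :: "'f \<Rightarrow> nat"
  fun_interp :: "'f \<Rightarrow> 'a list \<Rightarrow> 'a"
  rel_arity :: "'r \<Rightarrow> nat"
  rel_interp :: "'r \<Rightarrow> 'a list \<Rightarrow> bool"

datatype 'f tm = Var nat | App 'f "'f tm list"

datatype ('f, 'r) fm =
    Eq "'f tm" "'f tm"
  | Rel 'r "'f tm list"
  | Neg "('f, 'r) fm"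
  | Conj "('f, 'r) fm" "('f, 'r) fm"
  | Exi nat "('f, 'r) fm"

primrec wf_tm :: "('f, 'r, 'a) fo_struct \<Rightarrow> 'f tm \<Rightarrow> bool" where
  "wf_tm M (Var i) \<longleftrightarrow> True"
| "wf_tm M (App f ts) \<longleftrightarrow> length ts = fun_arity M f \<and> list_all (wf_tm M) ts"

primrec wf_fm :: "('f, 'r, 'a) fo_struct \<Rightarrow> ('f, 'r) fm \<Rightarrow> bool" where
  "wf_fm M (Eq s t) \<longleftrightarrow> wf_tm M s \<and> wf_tm M t"
| "wf_fm M (Rel r ts) \<longleftrightarrow> length ts = rel_arity M r \<and> list_all (wf_tm M) ts"
| "wf_fm M (Neg \<phi>) \<longleftrightarrow> wf_fm M \<phi>"
| "wf_fm M (Conj \<phi> \<psi>) \<longleftrightarrow> wf_fm M \<phi> \<and> wf_fm M \<psi>"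
| "wf_fm M (Exi i \<phi>) \<longleftrightarrow> wf_fm M \<phi>"

primrec eval_tm :: "('f, 'r, 'a) fo_struct \<Rightarrow> (nat \<Rightarrow> 'a) \<Rightarrow> 'f tm \<Rightarrow> 'a" where
  "eval_tm M e (Var i) = e i"
| "eval_tm M e (App f ts) = fun_interp M f (map (eval_tm M e) ts)"

primrec sat :: "('f, 'r, 'a) fo_struct \<Rightarrow> (nat \<Rightarrow> 'a) \<Rightarrow> ('f, 'r) fm \<Rightarrow> bool" where
  "sat M e (Eq s t) \<longleftrightarrow> eval_tm M e s = eval_tm M e t"
| "sat M e (Rel r ts) \<longleftrightarrow> rel_interp M r (map (eval_tm M e) ts)"
| "sat M e (Neg \<phi>) \<longleftrightarrow> \<not> sat M e \<phi>"
| "sat M e (Conj \<phi> \<psi>) \<longleftrightarrow> sat M e \<phi> \<and> sat M e \<psi>"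
| "sat M e (Exi i \<phi>) \<longleftrightarrow> (\<exists>a. sat M (e(i := a)) \<phi>)"

text \<open>
  Definability with parameters of a set of \<open>k\<close>-tuples, represented as lists of length \<open>k\<close>.
  The variables with index below \<open>k\<close> stand for the tuple; the values of \<open>e\<close> at the other free
  variables of \<open>\<phi>\<close>, of which there are only finitely many, are the parameters.
\<close>

definition definable :: "('f, 'r, 'a) fo_struct \<Rightarrow> nat \<Rightarrow> 'a list set \<Rightarrow> bool" where
  "definable M k X \<longleftrightarrow>
     (\<exists>\<phi> e. wf_fm M \<phi> \<and>
        X = {xs. length xs = k \<and> sat M (\<lambda>i. if i < k then xs ! i else e i) \<phi>})"

definition is_reduct_of ::
    "('f, 'r, 'a) fo_struct \<Rightarrow> ('g, 's, 'a) fo_struct \<Rightarrow> bool" where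
  "is_reduct_of M\<^sub>1 M\<^sub>2 \<longleftrightarrow> (\<forall>k X. definable M\<^sub>1 k X \<longrightarrow> definable M\<^sub>2 k X)"

text \<open>Elements of the circle are the cosets \<open>a +o \<int>\<close> of \<open>\<int>\<close> in the reals.\<close>

definition circle_order :: "real set \<Rightarrow> real set \<Rightarrow> real set \<Rightarrow> bool" where
  "circle_order A B D \<longleftrightarrow>
     (\<exists>a\<in>{0..<1}. \<exists>b\<in>{0..<1}. \<exists>c\<in>{0..<1}.
        A = a +o \<int> \<and> B = b +o \<int> \<and> D = c +o \<int> \<and>
        (a < b \<and> b < c \<or> b < c \<and> c < a \<or> c < a \<and> a < b))"

definition cyclic_order :: "real \<Rightarrow> int \<Rightarrow> int \<Rightarrow> int \<Rightarrow> bool" where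
  "cyclic_order \<alpha> j k l \<longleftrightarrow>
     circle_order ((\<alpha> * of_int j) +o \<int>) ((\<alpha> * of_int k) +o \<int>) ((\<alpha> * of_int l) +o \<int>)"

text \<open>The library's \<open>multiplicity p 0\<close> is \<open>0\<close>, whereas the valuation of \<open>0\<close> is infinite.\<close>

definition padic_val :: "nat \<Rightarrow> int \<Rightarrow> enat" where
  "padic_val p k = (if k = 0 then \<infinity> else enat (multiplicity (int p) k))"

definition padic_less :: "nat \<Rightarrow> int \<Rightarrow> int \<Rightarrow> bool" where
  "padic_less p k l \<longleftrightarrow> padic_val p k < padic_val p l"

datatype plus_sym = Plus
datatype cyc_sym = Cyc
datatype less_sym = Less

definition int_plus_cyc :: "real \<Rightarrow> (plus_sym, cyc_sym, int) fo_struct" where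
  "int_plus_cyc \<alpha> =
     \<lparr>fun_arity = (\<lambda>_. 2), fun_interp = (\<lambda>_ xs. xs ! 0 + xs ! 1),
      rel_arity = (\<lambda>_. 3), rel_interp = (\<lambda>_ xs. cyclic_order \<alpha> (xs ! 0) (xs ! 1) (xs ! 2))\<rparr>"

definition int_plus_less :: "(plus_sym, less_sym, int) fo_struct" where
  "int_plus_less =
     \<lparr>fun_arity = (\<lambda>_. 2), fun_interp = (\<lambda>_ xs. xs ! 0 + xs ! 1),
      rel_arity = (\<lambda>_. 2), rel_interp = (\<lambda>_ xs. xs ! 0 < xs ! 1)\<rparr>"

definition int_plus_padic :: "nat \<Rightarrow> (plus_sym, less_sym, int) fo_struct" where
  "int_plus_padic p =
     \<lparr>fun_arity = (\<lambda>_. 2), fun_interp = (\<lambda>_ xs. xs ! 0 + xs ! 1),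
      rel_arity = (\<lambda>_. 2), rel_interp = (\<lambda>_ xs. padic_less p (xs ! 0) (xs ! 1))\<rparr>"

end

theory Submission
  imports Defs "HOL-Analysis.Kronecker_Approximation_Theorem"
begin

text \<open>
  The set \<open>A\<close> of all \<open>k\<close> with \<open>C\<^sub>\<alpha>(0, k, 1)\<close> consists of the \<open>k\<close> for which the fractional part of
  \<open>\<alpha>k\<close> lies strictly between \<open>0\<close> and the fractional part of \<open>\<alpha>\<close>. By Kronecker's theorem, \<open>A\<close> has
  arbitrarily large elements, and every arithmetic progression \<open>k, k + D, k + 2D, \<dots>\<close> with \<open>D > 0\<close>
  leaves \<open>A\<close>, because \<open>\<alpha>D\<close> is irrational (\<open>arc_not_locally_periodic\<close>). A unary set that is definable
  in \<open>(\<int>; +, <)\<close> or in \<open>(\<int>; +, \<prec>\<^sub>p)\<close> behaves differently: for every large enough \<open>k\<close> there is a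
  \<open>D > 0\<close> such that all of \<open>k, k + D, k + 2D, \<dots>\<close> lie on the same side of the set
  (\<open>definable_less_locally_periodic\<close>, \<open>definable_padic_locally_periodic\<close>). Hence \<open>A\<close> is definable in
  neither structure.

  This property of definable sets comes from a quantifier elimination in back-and-forth form. Two
  assignments are similar at level \<open>N\<close> if they satisfy the same atomic conditions on affine forms
  with coefficients at most \<open>N\<close>, and agree modulo the small integers (in the p-adic case: modulo
  those prime to \<open>p\<close>). If they are similar at a sufficiently high level, then every value given to
  a variable on one side can be answered on the other side so that similarity survives at level \<open>N\<close>
  (\<open>order_sim_forth\<close>, \<open>padic_sim_forth\<close>). By induction on formulas, each formula is then decided by
  the similarity class at some level (\<open>additive_back_and_forth_sat\<close>). Finally, fix the parameters
  and let only the variable take the values \<open>k\<close> and \<open>k + Dq\<close>: for large \<open>k\<close> and a suitable \<open>D\<close> the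
  two assignments are similar, since each form \<open>ck + d\<close> with bounded \<open>c \<noteq> 0\<close> and \<open>d\<close> is nonzero, with
  the sign of \<open>c\<close>, and its p-adic valuation is unaffected by adding a multiple of a high power of \<open>p\<close>.

  To answer a value \<open>a\<close>, the conditions on \<open>ca + f\<close> are multiplied by a common multiple \<open>K\<close> of all
  coefficients, so that they become conditions on \<open>Ka\<close> relative to values of forms. Only the
  position of \<open>Ka\<close> relative to the nearest form matters: its distance, if small, and otherwise only
  its residue. In the ordered case near refers to the order; in the p-adic case it refers to the
  valuation, and a second comparison takes place in the value group.
\<close>

section \<open>Back-and-forth systems\<close>

primrec tm_vars :: "'f tm \<Rightarrow> nat set" where
  "tm_vars (Var i) = {i}"
| "tm_vars (App f ts) = \<Union> (set (map tm_vars ts))"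

primrec fm_vars :: "('f, 'r) fm \<Rightarrow> nat set" where
  "fm_vars (Eq s t) = tm_vars s \<union> tm_vars t"
| "fm_vars (Rel r ts) = (\<Union>t\<in>set ts. tm_vars t)"
| "fm_vars (Neg \<phi>) = fm_vars \<phi>"
| "fm_vars (Conj \<phi> \<psi>) = fm_vars \<phi> \<union> fm_vars \<psi>"
| "fm_vars (Exi i \<phi>) = insert i (fm_vars \<phi>)"

lemma finite_tm_vars: "finite (tm_vars t)"
  by (induction t) auto

lemma finite_fm_vars: "finite (fm_vars \<phi>)"
  by (induction \<phi>) (auto simp: finite_tm_vars)

text \<open>
  The standard game argument. The level drops at each quantifier by the amount that \<open>forth\<close>
  prescribes; symmetry of \<open>R\<close> supplies the answers in the other direction.
\<close>

lemma back_and_forth_sat: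
  fixes R :: "nat \<Rightarrow> (nat \<Rightarrow> 'a) \<Rightarrow> (nat \<Rightarrow> 'a) \<Rightarrow> bool"
  assumes sym: "\<And>N e e'. R N e e' \<Longrightarrow> R N e' e"
    and mono: "\<And>N N' e e'. R N' e e' \<Longrightarrow> N \<le> N' \<Longrightarrow> R N e e'"
    and forth: "\<And>N. \<exists>N'. \<forall>e e' i a. R N' e e' \<longrightarrow> i < n \<longrightarrow> (\<exists>b. R N (e(i := a)) (e'(i := b)))"
    and eq: "\<And>s t. wf_tm M s \<Longrightarrow> wf_tm M t \<Longrightarrow> tm_vars s \<union> tm_vars t \<subseteq> {..<n} \<Longrightarrow>
      \<exists>N. \<forall>e e'. R N e e' \<longrightarrow> (eval_tm M e s = eval_tm M e t \<longleftrightarrow> eval_tm M e' s = eval_tm M e' t)"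
    and rel: "\<And>r ts. length ts = rel_arity M r \<Longrightarrow> \<forall>t\<in>set ts. wf_tm M t \<and> tm_vars t \<subseteq> {..<n} \<Longrightarrow>
      \<exists>N. \<forall>e e'. R N e e' \<longrightarrow>
        (rel_interp M r (map (eval_tm M e) ts) \<longleftrightarrow> rel_interp M r (map (eval_tm M e') ts))"
    and "wf_fm M \<phi>" "fm_vars \<phi> \<subseteq> {..<n}"
  shows "\<exists>N. \<forall>e e'. R N e e' \<longrightarrow> (sat M e \<phi> \<longleftrightarrow> sat M e' \<phi>)"
  using assms(6,7)
proof (induction \<phi>)
  case (Eq s t)
  then show ?case using eq[of s t] by simp
next
  case (Rel r ts)
  then show ?case using rel[of ts r] by (auto simp: list_all_iff UN_subset_iff)
next
  case (Neg \<phi>)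
  then show ?case by simp
next
  case (Conj \<phi> \<psi>)
  then obtain N1 N2 where "\<forall>e e'. R N1 e e' \<longrightarrow> (sat M e \<phi> \<longleftrightarrow> sat M e' \<phi>)"
    "\<forall>e e'. R N2 e e' \<longrightarrow> (sat M e \<psi> \<longleftrightarrow> sat M e' \<psi>)"
    by auto
  then have "\<forall>e e'. R (max N1 N2) e e' \<longrightarrow> (sat M e (Conj \<phi> \<psi>) \<longleftrightarrow> sat M e' (Conj \<phi> \<psi>))"
    using mono[of "max N1 N2"] by (metis max.cobounded1 max.cobounded2 sat.simps(4))
  then show ?case by blast
next
  case (Exi i \<phi>)
  then obtain N where N: "\<And>e e'. R N e e' \<Longrightarrow> sat M e \<phi> \<longleftrightarrow> sat M e' \<phi>" and "i < n"
    by auto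
  obtain N' where N': "\<And>e e' i a. R N' e e' \<Longrightarrow> i < n \<Longrightarrow> \<exists>b. R N (e(i := a)) (e'(i := b))"
    using forth[of N] by blast
  have "sat M e' (Exi i \<phi>)" if "R N' e e'" "sat M e (Exi i \<phi>)" for e e'
    using that N' N \<open>i < n\<close> by (metis sat.simps(5))
  then show ?case using sym by blast
qed

section \<open>Affine forms\<close>

text \<open>
  Differences of additive terms with integer parameters have this shape. The bound leaves only
  finitely many forms, so that among their values there is one nearest to a given integer.
\<close>

definition affine_forms :: "nat \<Rightarrow> int \<Rightarrow> ((nat \<Rightarrow> int) \<Rightarrow> int) set" where
  "affine_forms n B =
     {\<lambda>e. c\<^sub>0 + (\<Sum>i<n. c i * e i) | c\<^sub>0 c. \<bar>c\<^sub>0\<bar> \<le> B \<and> (\<forall>i<n. \<bar>c i\<bar> \<le> B)}"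

lemma affine_forms_mono: "f \<in> affine_forms n B \<Longrightarrow> B \<le> B' \<Longrightarrow> f \<in> affine_forms n B'"
  unfolding affine_forms_def by force

lemma affine_forms_const: "\<bar>k\<bar> \<le> B \<Longrightarrow> (\<lambda>e. k) \<in> affine_forms n B"
  unfolding affine_forms_def by (auto intro!: exI[of _ k] exI[of _ "\<lambda>_. 0"])

lemma affine_forms_var: "i < n \<Longrightarrow> (\<lambda>e. e i) \<in> affine_forms n 1"
  unfolding affine_forms_def
  by (auto intro!: exI[of _ 0] exI[of _ "\<lambda>j. of_bool (j = i)"] simp: sum_of_bool_mult_eq)

lemma affine_forms_comb:
  assumes "f \<in> affine_forms n B" "g \<in> affine_forms n B'"
  shows "(\<lambda>e. x * f e + y * g e) \<in> affine_forms n (\<bar>x\<bar> * B + \<bar>y\<bar> * B')"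
proof -
  obtain c0 c d0 d where f: "f = (\<lambda>e. c0 + (\<Sum>i<n. c i * e i))" "\<bar>c0\<bar> \<le> B" "\<And>i. i < n \<Longrightarrow> \<bar>c i\<bar> \<le> B"
    and g: "g = (\<lambda>e. d0 + (\<Sum>i<n. d i * e i))" "\<bar>d0\<bar> \<le> B'" "\<And>i. i < n \<Longrightarrow> \<bar>d i\<bar> \<le> B'"
    using assms unfolding affine_forms_def by blast
  have bound: "\<bar>x * u + y * v\<bar> \<le> \<bar>x\<bar> * B + \<bar>y\<bar> * B'" if "\<bar>u\<bar> \<le> B" "\<bar>v\<bar> \<le> B'" for u v
    by (rule order_trans[OF abs_triangle_ineq]) (simp add: abs_mult add_mono mult_left_mono that)
  have "(\<lambda>e. x * f e + y * g e) = (\<lambda>e. (x * c0 + y * d0) + (\<Sum>i<n. (x * c i + y * d i) * e i))"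
    unfolding f(1) g(1) by (simp add: algebra_simps sum.distrib sum_distrib_left)
  then show ?thesis
    unfolding affine_forms_def using bound f(2,3) g(2,3)
    by (intro CollectI exI[of _ "x * c0 + y * d0"] exI[of _ "\<lambda>i. x * c i + y * d i"]) auto
qed

lemma affine_forms_scale:
  assumes "f \<in> affine_forms n B"
  shows "(\<lambda>e. x * f e) \<in> affine_forms n (\<bar>x\<bar> * B)"
  using affine_forms_comb[OF assms assms, of x 0] by simp

text \<open>
  Isolating the variable that is about to be quantified. The remainder \<open>g\<close> is evaluated at the old
  assignment, so that similarity of the old assignments applies to it.
\<close>

lemma affine_forms_update:
  assumes "f \<in> affine_forms n B" "i < n"
  obtains c g where "\<bar>c\<bar> \<le> B" "g \<in> affine_forms n B" "\<And>e a. f (e(i := a)) = c * a + g e"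
proof -
  obtain c0 c where f: "f = (\<lambda>e. c0 + (\<Sum>i<n. c i * e i))" "\<bar>c0\<bar> \<le> B" "\<And>i. i < n \<Longrightarrow> \<bar>c i\<bar> \<le> B"
    using assms unfolding affine_forms_def by blast
  let ?g = "\<lambda>e. c0 + (\<Sum>j<n. (c(i := 0)) j * e j)"
  have "f (e(i := a)) = c i * a + ?g e" for e a
    unfolding f(1) using assms(2)
    by (simp add: sum.remove[of "{..<n}" i])
  moreover have "?g \<in> affine_forms n B"
    unfolding affine_forms_def using f(2,3) by force
  ultimately show ?thesis using that f(3)[OF assms(2)] by blast
qed

lemma affine_forms_dvd_diff:
  assumes "f \<in> affine_forms n B" "\<And>i. i < n \<Longrightarrow> m dvd e i - e' i"
  shows "m dvd f e - f e'"
proof -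
  obtain c0 c where f: "f = (\<lambda>e. c0 + (\<Sum>i<n. c i * e i))"
    using assms(1) unfolding affine_forms_def by blast
  have "f e - f e' = (\<Sum>i<n. c i * (e i - e' i))"
    by (simp add: f sum_subtractf algebra_simps)
  then show ?thesis using assms(2) by (auto intro!: dvd_sum dvd_mult)
qed

lemma affine_forms_bound:
  assumes "f \<in> affine_forms n B"
  shows "\<bar>f e\<bar> \<le> B * (1 + (\<Sum>i<n. \<bar>e i\<bar>))"
proof -
  obtain c0 c where f: "f = (\<lambda>e. c0 + (\<Sum>i<n. c i * e i))" "\<bar>c0\<bar> \<le> B" "\<And>i. i < n \<Longrightarrow> \<bar>c i\<bar> \<le> B"
    using assms unfolding affine_forms_def by blast
  have "\<bar>f e\<bar> \<le> \<bar>c0\<bar> + (\<Sum>i<n. \<bar>c i * e i\<bar>)"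
    unfolding f(1) by (intro order_trans[OF abs_triangle_ineq] add_mono sum_abs) auto
  also have "\<dots> \<le> B + (\<Sum>i<n. B * \<bar>e i\<bar>)"
    using f(2,3) by (intro add_mono sum_mono) (auto simp: abs_mult mult_right_mono)
  finally show ?thesis by (simp add: algebra_simps sum_distrib_left)
qed

text \<open>
  Since addition is the only function, all terms are affine forms.
\<close>

lemma eval_tm_affine:
  assumes "fun_arity M = (\<lambda>_. 2)" "fun_interp M = (\<lambda>_ xs. xs ! 0 + xs ! 1)"
    and "wf_tm M t" "tm_vars t \<subseteq> {..<n}"
  shows "\<exists>B. (\<lambda>e. eval_tm M e t) \<in> affine_forms n B"
  using assms(3,4)
proof (induction t)
  case (Var i)
  then show ?case using affine_forms_var[of i n] by auto
next
  case (App f ts)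
  then have "length ts = 2" using assms(1) by simp
  then obtain s t where ts: "ts = [s, t]"
    by (auto simp: numeral_2_eq_2 length_Suc_conv)
  obtain B B' where "(\<lambda>e. eval_tm M e s) \<in> affine_forms n B" "(\<lambda>e. eval_tm M e t) \<in> affine_forms n B'"
    using App ts by fastforce
  from affine_forms_comb[OF this, of 1 1] show ?case
    using assms(2) ts by auto
qed

text \<open>
  For expansions of \<open>(\<int>; +)\<close> by one binary relation, the base case is a statement about two affine
  forms.
\<close>

lemma additive_back_and_forth_sat:
  fixes R :: "nat \<Rightarrow> (nat \<Rightarrow> int) \<Rightarrow> (nat \<Rightarrow> int) \<Rightarrow> bool"
  assumes M: "M = \<lparr>fun_arity = (\<lambda>_. 2), fun_interp = (\<lambda>_ xs. xs ! 0 + xs ! 1),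
      rel_arity = (\<lambda>_. 2), rel_interp = (\<lambda>_ xs. P (xs ! 0) (xs ! 1))\<rparr>"
    and sym: "\<And>N e e'. R N e e' \<Longrightarrow> R N e' e"
    and mono: "\<And>N N' e e'. R N' e e' \<Longrightarrow> N \<le> N' \<Longrightarrow> R N e e'"
    and forth: "\<And>N. \<exists>N'. \<forall>e e' i a. R N' e e' \<longrightarrow> i < n \<longrightarrow> (\<exists>b. R N (e(i := a)) (e'(i := b)))"
    and eq: "\<And>f g B B'. f \<in> affine_forms n B \<Longrightarrow> g \<in> affine_forms n B' \<Longrightarrow>
      \<exists>N. \<forall>e e'. R N e e' \<longrightarrow> (f e = g e \<longleftrightarrow> f e' = g e')"
    and rel: "\<And>f g B B'. f \<in> affine_forms n B \<Longrightarrow> g \<in> affine_forms n B' \<Longrightarrow>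
      \<exists>N. \<forall>e e'. R N e e' \<longrightarrow> (P (f e) (g e) \<longleftrightarrow> P (f e') (g e'))"
    and \<phi>: "wf_fm M \<phi>" "fm_vars \<phi> \<subseteq> {..<n}"
  shows "\<exists>N. \<forall>e e'. R N e e' \<longrightarrow> (sat M e \<phi> \<longleftrightarrow> sat M e' \<phi>)"
proof -
  have M_simps: "fun_arity M = (\<lambda>_. 2)" "fun_interp M = (\<lambda>_ xs. xs ! 0 + xs ! 1)"
    "rel_arity M = (\<lambda>_. 2)" "rel_interp M = (\<lambda>_ xs. P (xs ! 0) (xs ! 1))"
    by (simp_all add: M)
  note affine = eval_tm_affine[OF M_simps(1,2)]
  show ?thesis
  proof (rule back_and_forth_sat[where R = R and n = n, OF sym mono forth _ _ \<phi>])
    fix s t assume "wf_tm M s" "wf_tm M t" "tm_vars s \<union> tm_vars t \<subseteq> {..<n}"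
    then obtain B B' where "(\<lambda>e. eval_tm M e s) \<in> affine_forms n B" "(\<lambda>e. eval_tm M e t) \<in> affine_forms n B'"
      using affine by (metis le_sup_iff)
    from eq[OF this] show "\<exists>N. \<forall>e e'. R N e e' \<longrightarrow>
        (eval_tm M e s = eval_tm M e t \<longleftrightarrow> eval_tm M e' s = eval_tm M e' t)" .
  next
    fix r ts assume ts: "length ts = rel_arity M r" "\<forall>t\<in>set ts. wf_tm M t \<and> tm_vars t \<subseteq> {..<n}"
    then obtain s t where st: "ts = [s, t]"
      by (auto simp: M_simps numeral_2_eq_2 length_Suc_conv)
    then obtain B B' where "(\<lambda>e. eval_tm M e s) \<in> affine_forms n B" "(\<lambda>e. eval_tm M e t) \<in> affine_forms n B'"
      using affine[of s n] affine[of t n] ts(2) by auto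
    from rel[OF this] show "\<exists>N. \<forall>e e'. R N e e' \<longrightarrow>
        (rel_interp M r (map (eval_tm M e) ts) \<longleftrightarrow> rel_interp M r (map (eval_tm M e') ts))"
      by (simp add: M_simps st)
  qed
qed

section \<open>The ordered group of integers\<close>

definition order_sim :: "nat \<Rightarrow> nat \<Rightarrow> (nat \<Rightarrow> int) \<Rightarrow> (nat \<Rightarrow> int) \<Rightarrow> bool" where
  "order_sim n N e e' \<longleftrightarrow>
     (\<forall>f\<in>affine_forms n (int N). 0 < f e \<longleftrightarrow> 0 < f e') \<and>
     (\<forall>m\<in>{1..N}. \<forall>i<n. int m dvd e i - e' i)"

lemma order_sim_sym: "order_sim n N e e' \<Longrightarrow> order_sim n N e' e"
  unfolding order_sim_def by (metis dvd_diff_commute)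

lemma order_sim_mono: "order_sim n N' e e' \<Longrightarrow> N \<le> N' \<Longrightarrow> order_sim n N e e'"
  unfolding order_sim_def by (auto dest: affine_forms_mono[where B' = "int N'"])

lemma order_sim_pos: "order_sim n N e e' \<Longrightarrow> f \<in> affine_forms n (int N) \<Longrightarrow> 0 < f e \<longleftrightarrow> 0 < f e'"
  unfolding order_sim_def by blast

lemma order_sim_dvd:
  assumes "order_sim n N e e'" "0 < m" "m \<le> int N" "i < n"
  shows "m dvd e i - e' i"
proof -
  have "nat m \<in> {1..N}" using assms by auto
  then have "int (nat m) dvd e i - e' i"
    using assms unfolding order_sim_def by blast
  then show ?thesis using assms(2) by simp
qed

text \<open>
  The offset \<open>k\<close> makes it possible to compare distances between forms with a bounded number.
\<close>

lemma order_sim_less: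
  assumes "order_sim n N e e'" "f \<in> affine_forms n B" "g \<in> affine_forms n B'" "B + B' + \<bar>k\<bar> \<le> int N"
  shows "f e + k < g e \<longleftrightarrow> f e' + k < g e'"
proof -
  have "(\<lambda>e. g e - f e - k) \<in> affine_forms n (B' + B + \<bar>k\<bar>)"
    using affine_forms_comb[OF affine_forms_comb[OF assms(3,2), of 1 "-1"]
        affine_forms_const[of "- k" "\<bar>k\<bar>"], of 1 1]
    by simp
  then have "(\<lambda>e. g e - f e - k) \<in> affine_forms n (int N)"
    by (rule affine_forms_mono) (use assms(4) in linarith)
  then have "0 < g e - f e - k \<longleftrightarrow> 0 < g e' - f e' - k"
    using order_sim_pos[OF assms(1), of "\<lambda>e. g e - f e - k"] by blast
  then show ?thesis by linarith
qed

text \<open>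
  Let \<open>g\<close> be the form whose value is nearest below \<open>Ka\<close>. If the distance is at most \<open>K\<^sup>2\<close>, it is kept
  exactly: comparisons of forms with bounded offset transfer it. If it is larger, any distance in
  \<open>{1..K\<^sup>2}\<close> with the same residue works, as the next form above \<open>g\<close> is more than \<open>K\<^sup>2\<close> away on both
  sides. The modulus is \<open>K\<^sup>2\<close>, since the answer must be divisible by \<open>K\<close> and its quotient by \<open>K\<close> must
  still be congruent to \<open>a\<close> modulo \<open>K\<close>.
\<close>

lemma order_sim_near_point:
  fixes K T :: int
  assumes sim: "order_sim n N' e e'" and K: "K > 0" and T: "T \<ge> 0" and a: "a \<ge> 0"
    and N': "K * K \<le> int N'" "2 * T + K * K \<le> int N'"
  obtains b where "K dvd a - b"
    "\<And>f. f \<in> affine_forms n T \<Longrightarrow> f e < K * a \<longleftrightarrow> f e' < K * b"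
    "\<And>f. f \<in> affine_forms n T \<Longrightarrow> K * a < f e \<longleftrightarrow> K * b < f e'"
proof -
  have KK: "K * K > 0" using K by simp
  let ?P = "\<lambda>f. f \<in> affine_forms n T \<and> f e \<le> K * a"
  (* The zero form lies below K a, so that a nearest form from below exists. *)
  have "?P (\<lambda>_. 0)" using T K a by (simp add: affine_forms_const)
  from ex_has_least_nat[of ?P, OF this, of "\<lambda>f. nat (K * a - f e)"]
  obtain g where g: "g \<in> affine_forms n T" "g e \<le> K * a"
    and gmax: "\<And>f. f \<in> affine_forms n T \<Longrightarrow> f e \<le> K * a \<Longrightarrow> f e \<le> g e"
    by (smt (verit) nat_le_eq_zle)
  define \<delta> where "\<delta> = K * a - g e"
  define \<delta>' where "\<delta>' = (if \<delta> \<le> K * K then \<delta> else (\<delta> - 1) mod (K * K) + 1)"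
  have \<delta>'_bounds: "0 \<le> \<delta>'" "\<delta>' \<le> K * K" "\<delta> > K * K \<Longrightarrow> 0 < \<delta>'"
    using g(2) KK pos_mod_bound[OF KK, of "\<delta> - 1"] pos_mod_sign[OF KK, of "\<delta> - 1"]
    by (auto simp: \<delta>'_def \<delta>_def)
  have "K * K dvd \<delta> - \<delta>'"
  proof -
    have "K * K dvd (\<delta> - 1) - (\<delta> - 1) mod (K * K)"
      by (rule dvd_minus_mod)
    then show ?thesis by (simp add: \<delta>'_def diff_diff_eq add.commute)
  qed
  moreover have "K * K dvd g e - g e'"
    by (rule affine_forms_dvd_diff[OF g(1)]) (rule order_sim_dvd[OF sim KK N'(1)])
  ultimately have "K * K dvd (\<delta> - \<delta>') + (g e - g e')"
    by (rule dvd_add)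
  then have dvd: "K * K dvd K * a - (g e' + \<delta>')"
    by (simp add: \<delta>_def algebra_simps)
  then have "K dvd g e' + \<delta>'"
    by (metis dvd_mult_left dvd_triv_left dvd_diff_right_iff)
  then obtain b where b: "g e' + \<delta>' = K * b" by blast
  have "K dvd a - b"
    using dvd K unfolding b by (simp flip: right_diff_distrib)
  moreover have *: "(f e < K * a \<longleftrightarrow> f e' < K * b) \<and> (K * a < f e \<longleftrightarrow> K * b < f e')"
    if f: "f \<in> affine_forms n T" for f
  proof (cases "\<delta> \<le> K * K")
    case True
    then have "\<delta>' = \<delta>" "\<bar>\<delta>\<bar> \<le> K * K" "\<bar>- \<delta>\<bar> \<le> K * K" using \<delta>'_bounds by (auto simp: \<delta>'_def)
    then show ?thesis
      using order_sim_less[OF sim g(1) f, of \<delta>] order_sim_less[OF sim f g(1), of "- \<delta>"] N' b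
      unfolding \<delta>_def by auto
  next
    case False
    then have "0 < \<delta>'" using \<delta>'_bounds by simp
    show ?thesis
    proof (cases "f e \<le> K * a")
      case True
      then have "f e \<le> g e" using gmax f by blast
      then have "f e' \<le> g e'"
        using order_sim_less[OF sim g(1) f, of 0] N' KK by auto
      then show ?thesis using True \<open>f e \<le> g e\<close> False \<open>0 < \<delta>'\<close> b KK unfolding \<delta>_def by auto
    next
      case False
      then have "g e + K * K < f e" using \<open>\<not> \<delta> \<le> K * K\<close> unfolding \<delta>_def by auto
      then have "g e' + K * K < f e'"
        using order_sim_less[OF sim g(1) f, of "K * K"] N' KK by auto
      then show ?thesis using False \<delta>'_bounds b by auto
    qed
  qed
  ultimately show thesis using that by blast
qed

text \<open>
  A form below \<open>Ka\<close> need not exist if \<open>a < 0\<close>; the set of forms is closed under negation, so that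
  the answer to \<open>- a\<close> can be negated.
\<close>

lemma order_sim_near_point_signed:
  fixes K T :: int
  assumes sim: "order_sim n N' e e'" and K: "K > 0" and T: "T \<ge> 0"
    and N': "K * K \<le> int N'" "2 * T + K * K \<le> int N'"
  obtains b where "K dvd a - b"
    "\<And>f. f \<in> affine_forms n T \<Longrightarrow> f e < K * a \<longleftrightarrow> f e' < K * b"
    "\<And>f. f \<in> affine_forms n T \<Longrightarrow> K * a < f e \<longleftrightarrow> K * b < f e'"
proof (cases "a \<ge> 0")
  case True
  then show thesis using order_sim_near_point[OF sim K T _ N'] that by blast
next
  case False
  then obtain b where b: "K dvd - a - b"
    "\<And>f. f \<in> affine_forms n T \<Longrightarrow> f e < K * - a \<longleftrightarrow> f e' < K * b"
    "\<And>f. f \<in> affine_forms n T \<Longrightarrow> K * - a < f e \<longleftrightarrow> K * b < f e'"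
    using order_sim_near_point[OF sim K T _ N', of "- a"] by (metis linear neg_0_le_iff_le)
  have neg: "(\<lambda>e. - f e) \<in> affine_forms n T" if "f \<in> affine_forms n T" for f
    using affine_forms_scale[OF that, of "- 1"] by simp
  have "K dvd a - - b"
    using b(1) dvd_minus_iff[of K "- a - b"] by (simp add: algebra_simps)
  moreover have "f e < K * a \<longleftrightarrow> f e' < K * - b" "K * a < f e \<longleftrightarrow> K * - b < f e'"
    if "f \<in> affine_forms n T" for f
    using b(2,3)[OF neg[OF that]] by auto
  ultimately show thesis using that by blast
qed

text \<open>
  Clearing coefficients: if \<open>K = \<bar>c\<bar> d\<close>, then \<open>0 < ca + f\<close> compares \<open>Ka\<close> with \<open>- d f\<close> or with
  \<open>d f\<close>, according to the sign of \<open>c\<close>, and these forms have coefficients at most \<open>N K\<close>.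
\<close>

lemma order_sim_forth:
  "\<exists>N'. \<forall>e e' i a. order_sim n N' e e' \<longrightarrow> i < n \<longrightarrow> (\<exists>b. order_sim n N (e(i := a)) (e'(i := b)))"
proof -
  define K :: nat where "K = fact N"
  have K: "K > 0" by (simp add: K_def)
  have dvdK: "m dvd K" if "m \<in> {1..N}" for m
    using that by (simp add: K_def dvd_fact)
  define N' where "N' = K * K + 2 * (N * K) + N"
  have "\<exists>b. order_sim n N (e(i := a)) (e'(i := b))" if sim: "order_sim n N' e e'" and i: "i < n" for e e' i a
  proof -
    obtain b where Kab: "int K dvd a - b"
      and lower: "\<And>f. f \<in> affine_forms n (int N * int K) \<Longrightarrow> f e < int K * a \<longleftrightarrow> f e' < int K * b"
      and upper: "\<And>f. f \<in> affine_forms n (int N * int K) \<Longrightarrow> int K * a < f e \<longleftrightarrow> int K * b < f e'"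
      using order_sim_near_point_signed[OF sim, of "int K" "int N * int K" a] K
      by (auto simp: N'_def)
    have simN: "order_sim n N e e'"
      by (rule order_sim_mono[OF sim]) (simp add: N'_def)
    have "0 < f (e(i := a)) \<longleftrightarrow> 0 < f (e'(i := b))" if f_in: "f \<in> affine_forms n (int N)" for f
    proof -
      obtain c g where c: "\<bar>c\<bar> \<le> int N" and g: "g \<in> affine_forms n (int N)"
        and f: "\<And>e a. f (e(i := a)) = c * a + g e"
        using affine_forms_update[OF f_in i] by blast
      show ?thesis
      proof (cases "c = 0")
        case True
        then show ?thesis using simN g by (simp add: f order_sim_def)
      next
        case False
        then have "nat \<bar>c\<bar> dvd K" using c by (intro dvdK) auto
        then have "\<bar>c\<bar> dvd int K" by (metis int_dvd_int_iff int_nat_eq abs_ge_zero)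
        then obtain d where d: "int K = \<bar>c\<bar> * d" by blast
        have "d > 0" using K d by (metis False of_nat_0_less_iff zero_less_abs_iff zero_less_mult_pos)
        have "d \<le> int K" using d False \<open>d > 0\<close> by (simp add: mult_le_cancel_right1)
        then have h: "(\<lambda>e. x * g e) \<in> affine_forms n (int N * int K)" if "\<bar>x\<bar> = d" for x
          using affine_forms_mono[OF affine_forms_scale[OF g, of x], of "int N * int K"] that
            mult_left_mono[OF \<open>d \<le> int K\<close>, of "int N"]
          by (simp add: mult.commute[of d])
        show ?thesis
        proof (cases "c > 0")
          case True
          have "0 < c * a + g e \<longleftrightarrow> - d * g e < int K * a" for a e
            using \<open>d > 0\<close> True zero_less_mult_iff[of d "c * a + g e"] by (auto simp: d algebra_simps)
          then show ?thesis unfolding f using lower[OF h[of "- d"]] \<open>d > 0\<close> by auto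
        next
          case neg: False
          have "0 < c * a + g e \<longleftrightarrow> int K * a < d * g e" for a e
            using \<open>d > 0\<close> neg zero_less_mult_iff[of d "c * a + g e"] by (auto simp: d algebra_simps)
          then show ?thesis unfolding f using upper[OF h[of d]] \<open>d > 0\<close> by auto
        qed
      qed
    qed
    moreover have "int m dvd (e(i := a)) j - (e'(i := b)) j" if "m \<in> {1..N}" "j < n" for m j
      using simN that dvdK[OF that(1)] Kab unfolding order_sim_def
      by (auto intro: dvd_trans[of "int m" "int K"])
    ultimately show ?thesis unfolding order_sim_def by blast
  qed
  then show ?thesis by blast
qed

lemma order_sim_sat:
  assumes "wf_fm int_plus_less \<phi>" "fm_vars \<phi> \<subseteq> {..<n}"
  shows "\<exists>N. \<forall>e e'. order_sim n N e e' \<longrightarrow> (sat int_plus_less e \<phi> \<longleftrightarrow> sat int_plus_less e' \<phi>)"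
proof (rule additive_back_and_forth_sat[where R = "order_sim n", OF int_plus_less_def
      order_sim_sym order_sim_mono order_sim_forth _ _ assms])
  fix f g B B' assume "f \<in> affine_forms n B" "g \<in> affine_forms n B'"
  then have less: "f e < g e \<longleftrightarrow> f e' < g e'" "g e < f e \<longleftrightarrow> g e' < f e'"
    if "order_sim n (nat (B + B')) e e'" for e e'
    using that order_sim_less[of n "nat (B + B')" e e' _ _ _ _ 0] by auto
  show "\<exists>N. \<forall>e e'. order_sim n N e e' \<longrightarrow> (f e < g e \<longleftrightarrow> f e' < g e')"
    using less by blast
  show "\<exists>N. \<forall>e e'. order_sim n N e e' \<longrightarrow> (f e = g e \<longleftrightarrow> f e' = g e')"
    using less by (metis linorder_neq_iff)
qed

section \<open>The p-adic valuation of integers\<close>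

lemma padic_val_zero [simp]: "padic_val p 0 = \<infinity>"
  by (simp add: padic_val_def)

lemma padic_val_eq_infinity_iff [simp]: "padic_val p x = \<infinity> \<longleftrightarrow> x = 0"
  by (simp add: padic_val_def)

lemma padic_val_less_infinity_iff [simp]: "padic_val p x < \<infinity> \<longleftrightarrow> x \<noteq> 0"
  by (simp add: padic_val_def)

lemma padic_val_minus [simp]: "padic_val p (- x) = padic_val p x"
  using multiplicity_times_unit_right[of "- 1" "int p" x] by (simp add: padic_val_def)

lemma padic_val_mult: "prime p \<Longrightarrow> padic_val p (x * y) = padic_val p x + padic_val p y"
  by (auto simp: padic_val_def prime_elem_multiplicity_mult_distrib)

lemma power_dvd_iff_padic_val:
  assumes "prime p"
  shows "int p ^ k dvd x \<longleftrightarrow> enat k \<le> padic_val p x"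
proof (cases "x = 0")
  case False
  have "\<not> is_unit (int p)" using assms prime_gt_1_nat[OF assms] by simp
  then show ?thesis using False power_dvd_iff_le_multiplicity[of x "int p" k]
    by (simp add: padic_val_def)
qed simp

lemma padic_val_power: "prime p \<Longrightarrow> padic_val p (int p ^ k) = enat k"
  using prime_gt_1_nat[of p] by (auto simp: padic_val_def multiplicity_same_power)

lemma padic_val_coprime: "prime p \<Longrightarrow> \<not> int p dvd x \<Longrightarrow> padic_val p x = 0"
  by (auto simp: padic_val_def not_dvd_imp_multiplicity_0 zero_enat_def)

lemma padic_val_add_ge:
  assumes "prime p"
  shows "min (padic_val p x) (padic_val p y) \<le> padic_val p (x + y)"
proof (rule ccontr)
  assume less: "\<not> ?thesis"
  then obtain k where k: "padic_val p (x + y) = enat k"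
    by (metis enat_ord_simps(3) not_infinity_eq)
  have "enat (Suc k) \<le> padic_val p x" "enat (Suc k) \<le> padic_val p y"
    using less unfolding k by (simp_all add: Suc_ile_eq not_le)
  then have "int p ^ Suc k dvd x + y"
    unfolding power_dvd_iff_padic_val[OF assms, symmetric] by (rule dvd_add)
  then show False
    unfolding power_dvd_iff_padic_val[OF assms] k by simp
qed

lemma padic_val_add_less:
  assumes "prime p" "padic_val p x < padic_val p y"
  shows "padic_val p (x + y) = padic_val p x"
proof (rule antisym)
  show "padic_val p x \<le> padic_val p (x + y)"
    using padic_val_add_ge[OF assms(1), of x y] assms(2) by (simp add: min_def split: if_splits)
  show "padic_val p (x + y) \<le> padic_val p x"
    using padic_val_add_ge[OF assms(1), of "x + y" "- y"] assms(2) by (auto simp: min_def split: if_splits)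
qed

lemma padic_val_add_neq:
  assumes "prime p" "padic_val p x \<noteq> padic_val p y"
  shows "padic_val p (x + y) = min (padic_val p x) (padic_val p y)"
  using padic_val_add_less[OF assms(1), of x y] padic_val_add_less[OF assms(1), of y x] assms(2)
  by (auto simp: min_def add.commute neq_iff)

text \<open>
  Bounded nonzero integers have bounded valuation, because \<open>k < p\<^sup>k\<close>.
\<close>

lemma padic_val_less:
  assumes "prime p" "x \<noteq> 0" "\<bar>x\<bar> \<le> int k"
  shows "padic_val p x < enat k"
proof (rule ccontr)
  assume "\<not> ?thesis"
  then have "int p ^ k dvd x"
    unfolding power_dvd_iff_padic_val[OF assms(1)] by (rule leI)
  from dvd_imp_le_int[OF assms(2) this] have "int (p ^ k) \<le> \<bar>x\<bar>"
    by simp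
  then have "int (p ^ k) \<le> int k"
    using assms(3) by linarith
  moreover have "k < p ^ k"
    using prime_gt_1_nat[OF assms(1)] by (intro power_gt_expt) simp
  ultimately show False by linarith
qed

lemma padic_val_mult_less_cancel:
  assumes "prime p"
  shows "padic_val p (x * z) < padic_val p (y * z) \<longleftrightarrow> z \<noteq> 0 \<and> padic_val p x < padic_val p y"
proof (cases "z = 0")
  case False
  then obtain k where "padic_val p z = enat k" by (cases "padic_val p z") auto
  then show ?thesis using False
    by (cases "padic_val p x"; cases "padic_val p y") (auto simp: padic_val_mult[OF assms])
qed simp

section \<open>The integers with p-adic comparison\<close>

text \<open>
  Congruences modulo powers of \<open>p\<close> are already comparisons of valuations with the constants
  \<open>p\<^sup>k\<close>, hence only moduli prime to \<open>p\<close> appear separately.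
\<close>

definition padic_sim :: "nat \<Rightarrow> nat \<Rightarrow> nat \<Rightarrow> (nat \<Rightarrow> int) \<Rightarrow> (nat \<Rightarrow> int) \<Rightarrow> bool" where
  "padic_sim p n N e e' \<longleftrightarrow>
     (\<forall>f\<in>affine_forms n (int N). \<forall>g\<in>affine_forms n (int N).
        padic_less p (f e) (g e) \<longleftrightarrow> padic_less p (f e') (g e')) \<and>
     (\<forall>m\<in>{1..N}. coprime m p \<longrightarrow> (\<forall>i<n. int m dvd e i - e' i))"

lemma padic_sim_sym: "padic_sim p n N e e' \<Longrightarrow> padic_sim p n N e' e"
  unfolding padic_sim_def by (simp add: dvd_diff_commute[of _ "e _" "e' _"])

lemma padic_sim_mono:
  assumes "padic_sim p n N' e e'" "N \<le> N'"
  shows "padic_sim p n N e e'"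
proof -
  have "affine_forms n (int N) \<subseteq> affine_forms n (int N')" "{1..N} \<subseteq> {1..N'}"
    using assms(2) affine_forms_mono by auto
  then show ?thesis using assms(1) unfolding padic_sim_def by blast
qed

lemma padic_sim_less:
  assumes "padic_sim p n N e e'" "f \<in> affine_forms n B" "B \<le> int N"
    "g \<in> affine_forms n B'" "B' \<le> int N"
  shows "padic_val p (f e) < padic_val p (g e) \<longleftrightarrow> padic_val p (f e') < padic_val p (g e')"
  using assms affine_forms_mono unfolding padic_sim_def padic_less_def by blast

lemma padic_sim_eq:
  assumes "padic_sim p n N e e'" "f \<in> affine_forms n B" "B \<le> int N"
    "g \<in> affine_forms n B'" "B' \<le> int N"
  shows "padic_val p (f e) = padic_val p (g e) \<longleftrightarrow> padic_val p (f e') = padic_val p (g e')"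
  unfolding order.eq_iff not_less[symmetric]
  using padic_sim_less[OF assms] padic_sim_less[OF assms(1,4,5,2,3)] by simp

lemma padic_sim_eq_0:
  assumes "padic_sim p n N e e'" "f \<in> affine_forms n B" "B \<le> int N"
  shows "f e = 0 \<longleftrightarrow> f e' = 0"
proof -
  have "padic_val p (f e) < padic_val p 0 \<longleftrightarrow> padic_val p (f e') < padic_val p 0"
    by (rule padic_sim_less[OF assms affine_forms_const[of 0 0]]) simp_all
  then show ?thesis by simp
qed

text \<open>
  The pair \<open>(e', w')\<close> looks like \<open>(e, w)\<close> in all comparisons of \<open>cw\<close> with a form. The third condition
  says that if \<open>cw\<close> and \<open>f\<close> do not cancel p-adically in their sum, then neither do \<open>cw'\<close> and \<open>f\<close>.
\<close>

definition padic_match ::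
    "nat \<Rightarrow> nat \<Rightarrow> int \<Rightarrow> int \<Rightarrow> (nat \<Rightarrow> int) \<Rightarrow> int \<Rightarrow> (nat \<Rightarrow> int) \<Rightarrow> int \<Rightarrow> bool" where
  "padic_match p n C B e w e' w' \<longleftrightarrow>
     (\<forall>c f. \<bar>c\<bar> \<le> C \<longrightarrow> f \<in> affine_forms n B \<longrightarrow>
        (padic_val p (c * w) < padic_val p (f e) \<longleftrightarrow> padic_val p (c * w') < padic_val p (f e')) \<and>
        (padic_val p (f e) < padic_val p (c * w) \<longleftrightarrow> padic_val p (f e') < padic_val p (c * w')) \<and>
        (padic_val p (c * w + f e) = min (padic_val p (c * w)) (padic_val p (f e)) \<longrightarrow>
          padic_val p (c * w' + f e') = min (padic_val p (c * w')) (padic_val p (f e'))))"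

lemma padic_matchI:
  assumes sim: "padic_sim p n N e e'" "B \<le> int N"
    and "w = 0 \<longleftrightarrow> w' = 0"
    and *: "\<And>c f. w \<noteq> 0 \<Longrightarrow> c \<noteq> 0 \<Longrightarrow> \<bar>c\<bar> \<le> C \<Longrightarrow> f \<in> affine_forms n B \<Longrightarrow>
        (padic_val p (c * w) < padic_val p (f e) \<longleftrightarrow> padic_val p (c * w') < padic_val p (f e')) \<and>
        (padic_val p (f e) < padic_val p (c * w) \<longleftrightarrow> padic_val p (f e') < padic_val p (c * w')) \<and>
        (padic_val p (c * w + f e) = min (padic_val p (c * w)) (padic_val p (f e)) \<longrightarrow>
          padic_val p (c * w' + f e') = min (padic_val p (c * w')) (padic_val p (f e')))"
  shows "padic_match p n C B e w e' w'"
  unfolding padic_match_def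
proof (intro allI impI)
  fix c f assume c: "\<bar>c\<bar> \<le> C" and f: "f \<in> affine_forms n B"
  show "(padic_val p (c * w) < padic_val p (f e) \<longleftrightarrow> padic_val p (c * w') < padic_val p (f e')) \<and>
        (padic_val p (f e) < padic_val p (c * w) \<longleftrightarrow> padic_val p (f e') < padic_val p (c * w')) \<and>
        (padic_val p (c * w + f e) = min (padic_val p (c * w)) (padic_val p (f e)) \<longrightarrow>
          padic_val p (c * w' + f e') = min (padic_val p (c * w')) (padic_val p (f e')))"
  proof (cases "w = 0 \<or> c = 0")
    case True
    then have 0: "c * w = 0" "c * w' = 0" using assms(3) by auto
    show ?thesis unfolding 0 using padic_sim_eq_0[OF sim(1) f sim(2)] by simp
  next
    case False
    then show ?thesis using * c f by blast
  qed
qed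

text \<open>
  A witness \<open>\<eta>\<close> may be replaced by any \<open>w'\<close> in the open ball of radius \<open>v(\<eta>)\<close> around it, since only
  leading p-adic digits enter. This leaves the residues of \<open>w'\<close> modulo integers prime to \<open>p\<close> free.
\<close>

lemma padic_match_close:
  assumes p: "prime p" and sim: "padic_sim p n N e e'" "B \<le> int N"
    and match: "padic_match p n C B e w e' \<eta>" and "w \<noteq> 0" and \<eta>: "padic_val p \<eta> = enat k"
    and close: "int p ^ Suc k dvd w' - \<eta>"
  shows "padic_match p n C B e w e' w'"
proof -
  have "enat k < padic_val p (w' - \<eta>)"
    using close unfolding power_dvd_iff_padic_val[OF p] Suc_ile_eq .
  then have less: "padic_val p (c * \<eta>) < padic_val p (c * (w' - \<eta>))" if "c \<noteq> 0" for c
    using padic_val_mult_less_cancel[OF p, of \<eta> c "w' - \<eta>"] that by (simp add: \<eta> mult.commute)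
  have val: "padic_val p (c * w') = padic_val p (c * \<eta>)" if "c \<noteq> 0" for c
    using padic_val_add_less[OF p less[OF that]] by (simp add: algebra_simps)
  have "w' \<noteq> 0" using val[of 1] \<eta> by auto
  show ?thesis
  proof (rule padic_matchI[OF sim])
    fix c f assume c: "c \<noteq> 0" "\<bar>c\<bar> \<le> C" and f: "f \<in> affine_forms n B"
    let ?v = "padic_val p"
    have m: "(?v (c * w) < ?v (f e) \<longleftrightarrow> ?v (c * \<eta>) < ?v (f e')) \<and>
        (?v (f e) < ?v (c * w) \<longleftrightarrow> ?v (f e') < ?v (c * \<eta>)) \<and>
        (?v (c * w + f e) = min (?v (c * w)) (?v (f e)) \<longrightarrow>
          ?v (c * \<eta> + f e') = min (?v (c * \<eta>)) (?v (f e')))"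
      using match c f unfolding padic_match_def by blast
    have "?v (c * w' + f e') = min (?v (c * w')) (?v (f e'))"
      if "?v (c * w + f e) = min (?v (c * w)) (?v (f e))"
    proof (cases "?v (c * w') = ?v (f e')")
      case False
      then show ?thesis by (rule padic_val_add_neq[OF p])
    next
      case True
      then have eq: "?v (c * \<eta> + f e') = ?v (c * \<eta>)"
        using m that val[OF c(1)] by simp
      then have "?v ((c * \<eta> + f e') + c * (w' - \<eta>)) = ?v (c * \<eta>)"
        using padic_val_add_less[OF p, of "c * \<eta> + f e'" "c * (w' - \<eta>)"] less[OF c(1)] by simp
      then show ?thesis using True val[OF c(1)] by (simp add: algebra_simps)
    qed
    then show "(?v (c * w) < ?v (f e) \<longleftrightarrow> ?v (c * w') < ?v (f e')) \<and>
        (?v (f e) < ?v (c * w) \<longleftrightarrow> ?v (f e') < ?v (c * w')) \<and>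
        (?v (c * w + f e) = min (?v (c * w)) (?v (f e)) \<longrightarrow>
          ?v (c * w' + f e') = min (?v (c * w')) (?v (f e')))"
      using m val[OF c(1)] by simp
  qed (use \<open>w \<noteq> 0\<close> \<open>w' \<noteq> 0\<close> in simp)
qed

lemma prime_residue_ratio:
  fixes u v :: int
  assumes "prime p" "\<not> int p dvd u" "\<not> int p dvd v"
  obtains \<omega> where "0 < \<omega>" "\<omega> < int p" "\<not> int p dvd \<omega>" "int p dvd v - \<omega> * u"
proof -
  have "coprime (int p) u"
    using assms(1,2) by (intro prime_imp_coprime) auto
  then have "gcd (int p) u = 1" by simp
  with bezout_int[of "int p" u] obtain x y where "x * int p + y * u = 1" by auto
  define \<omega> where "\<omega> = (v * y) mod int p"
  have "int p dvd v * y - \<omega>" by (simp add: \<omega>_def dvd_minus_mod)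
  then have "int p dvd (v * y - \<omega>) * u + v * x * int p" by simp
  also have "(v * y - \<omega>) * u + v * x * int p = v * (x * int p + y * u) - \<omega> * u"
    by (simp add: algebra_simps)
  finally have dvd: "int p dvd v - \<omega> * u"
    using \<open>x * int p + y * u = 1\<close> by simp
  have "\<not> int p dvd \<omega>"
  proof
    assume "int p dvd \<omega>"
    then have "int p dvd (v - \<omega> * u) + \<omega> * u" using dvd by (intro dvd_add) auto
    then show False using assms(3) by simp
  qed
  moreover from this have "\<omega> \<noteq> 0" by auto
  moreover have "0 < int p" using prime_gt_0_nat[OF assms(1)] by simp
  then have "0 \<le> \<omega>" "\<omega> < int p"
    unfolding \<omega>_def by simp_all
  ultimately show thesis using that[of \<omega>] dvd by simp
qed

lemma padic_unit_part:
  assumes "prime p" "padic_val p x = enat k"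
  obtains u where "x = int p ^ k * u" "\<not> int p dvd u"
proof -
  have "int p ^ k dvd x" using assms by (simp add: power_dvd_iff_padic_val)
  then obtain u where u: "x = int p ^ k * u" by blast
  have "\<not> int p ^ Suc k dvd x" using assms by (simp add: power_dvd_iff_padic_val del: power_Suc)
  then have "\<not> int p dvd u" by (auto simp: u)
  then show thesis using that u by blast
qed

text \<open>
  Here the valuation of \<open>w\<close> differs from that of some form \<open>g\<close> by a bounded amount \<open>j\<close>. Then
  \<open>p\<^sup>j w\<close> and \<open>\<omega> g\<close> have the same leading p-adic digit for some \<open>\<omega> < p\<close>, and the number \<open>\<eta>\<close> with
  \<open>p\<^sup>j \<eta> = \<omega> g(e')\<close> is a witness: every question about \<open>cw + f\<close> becomes, after multiplication by
  \<open>p\<^sup>j\<close>, a question about the forms \<open>c\<omega>g + p\<^sup>j f\<close>, \<open>cg\<close> and \<open>p\<^sup>j f\<close>. The same use of a form as a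
  leading digit ensures that \<open>\<eta>\<close> avoids the residue classes that other forms occupy.
\<close>

lemma padic_match_near:
  fixes B C W :: int
  assumes p: "prime p" and sim: "padic_sim p n N e e'" and "1 \<le> B" "1 \<le> C" "B \<le> int N"
    and w: "w \<noteq> 0" "padic_val p w = enat E"
    and g: "g \<in> affine_forms n W" "padic_val p (g e) = enat (E + j)"
    and N: "C * int p * W + int p ^ j * B \<le> int N" "C * W \<le> int N"
  shows "\<exists>\<eta>. \<eta> \<noteq> 0 \<and> padic_match p n C B e w e' \<eta>"
proof -
  let ?v = "padic_val p"
  have p0: "int p > 0" "int p ^ j > 0" using prime_gt_0_nat[OF p] by auto
  have W: "0 \<le> W" using affine_forms_bound[OF g(1), of "\<lambda>_. 0"] by auto
  have "W \<le> C * W" using W \<open>1 \<le> C\<close> by (simp add: mult_le_cancel_right1)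
  moreover have "0 \<le> C * int p * W" "int p ^ j * 1 \<le> int p ^ j * B"
    using W \<open>1 \<le> C\<close> \<open>1 \<le> B\<close> p0 by (auto intro!: mult_left_mono)
  ultimately have NW: "W \<le> int N" "int p ^ j \<le> int N" "int p ^ j * B \<le> int N"
    using N by linarith+
  obtain u where u: "g e = int p ^ (E + j) * u" "\<not> int p dvd u"
    using padic_unit_part[OF p g(2)] .
  obtain v where v: "w = int p ^ E * v" "\<not> int p dvd v"
    using padic_unit_part[OF p w(2)] .
  obtain \<omega> where \<omega>: "0 < \<omega>" "\<omega> < int p" "\<not> int p dvd \<omega>" "int p dvd v - \<omega> * u"
    using prime_residue_ratio[OF p u(2) v(2)] .
  have v\<omega>: "?v \<omega> = 0" by (rule padic_val_coprime[OF p \<omega>(3)])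
  have "int p ^ (E + j) * int p dvd int p ^ (E + j) * (v - \<omega> * u)"
    using \<omega>(4) by (rule mult_dvd_mono[OF dvd_refl])
  then have close: "enat (Suc (E + j)) \<le> ?v (int p ^ j * w - \<omega> * g e)"
    unfolding power_dvd_iff_padic_val[OF p, symmetric]
    by (simp add: u(1) v(1) power_add algebra_simps)
  have "\<not> ?v (g e) < ?v (int p ^ j)" by (simp add: g(2) padic_val_power[OF p])
  then have "\<not> ?v (g e') < ?v (int p ^ j)"
    using padic_sim_less[OF sim g(1) NW(1) affine_forms_const[of "int p ^ j" "int p ^ j"]] NW(2) by simp
  then have "int p ^ j dvd \<omega> * g e'"
    by (simp add: power_dvd_iff_padic_val[OF p] padic_val_power[OF p] padic_val_mult[OF p] v\<omega>)
  then obtain \<eta> where \<eta>: "\<omega> * g e' = int p ^ j * \<eta>" by blast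
  have "g e' \<noteq> 0"
    using padic_sim_eq_0[OF sim g(1) NW(1)] g(2) by auto
  then have "\<eta> \<noteq> 0" using \<eta> \<omega>(1) by auto
  have vw: "?v (int p ^ j * (c * w)) = ?v (c * g e)" for c
    by (cases "?v c") (simp_all add: padic_val_mult[OF p] padic_val_power[OF p] w(2) g(2))
  have v\<eta>: "?v (int p ^ j * (c * \<eta>)) = ?v (c * g e')" for c
  proof -
    have "int p ^ j * (c * \<eta>) = c * (\<omega> * g e')" by (simp add: \<eta>)
    then have "?v (int p ^ j * (c * \<eta>)) = ?v (c * (\<omega> * g e'))" by (simp only:)
    then show ?thesis by (simp only: padic_val_mult[OF p] v\<omega> add_0)
  qed
  have scale: "?v (int p ^ j * x) < ?v (int p ^ j * y) \<longleftrightarrow> ?v x < ?v y" for x y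
    using padic_val_mult_less_cancel[OF p, of x "int p ^ j" y] p0 by (simp add: mult.commute)
  have scale_eq: "?v (int p ^ j * x) = ?v (int p ^ j * y) \<longleftrightarrow> ?v x = ?v y" for x y
    using scale[of x y] scale[of y x] by (cases "?v x" "?v y" rule: linorder_cases) auto
  have "padic_match p n C B e w e' \<eta>"
  proof (rule padic_matchI[OF sim])
    fix c f assume c: "c \<noteq> 0" "\<bar>c\<bar> \<le> C" and f: "f \<in> affine_forms n B"
    have cg: "(\<lambda>e. c * g e) \<in> affine_forms n (C * W)"
      using affine_forms_mono[OF affine_forms_scale[OF g(1), of c]] c(2) W by (simp add: mult_right_mono)
    have pf: "(\<lambda>e. int p ^ j * f e) \<in> affine_forms n (int p ^ j * B)"
      using affine_forms_scale[OF f, of "int p ^ j"] p0 by simp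
    have lt: "?v (c * w) < ?v (f e) \<longleftrightarrow> ?v (c * \<eta>) < ?v (f e')"
      using padic_sim_less[OF sim cg N(2) pf NW(3)]
      unfolding vw[symmetric] v\<eta>[symmetric] scale .
    have gt: "?v (f e) < ?v (c * w) \<longleftrightarrow> ?v (f e') < ?v (c * \<eta>)"
      using padic_sim_less[OF sim pf NW(3) cg N(2)]
      unfolding vw[symmetric] v\<eta>[symmetric] scale .
    have "?v (c * \<eta> + f e') = min (?v (c * \<eta>)) (?v (f e'))"
      if sum: "?v (c * w + f e) = min (?v (c * w)) (?v (f e))"
    proof (cases "?v (c * \<eta>) = ?v (f e')")
      case False
      then show ?thesis by (rule padic_val_add_neq[OF p])
    next
      case True
      then have "?v (c * w) = ?v (f e)"
        using lt gt unfolding order.eq_iff not_less[symmetric] by simp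
      then have eq: "?v (c * w + f e) = ?v (c * w)" using sum by simp
      let ?h = "\<lambda>e. (c * \<omega>) * g e + int p ^ j * f e"
      have "\<bar>c * \<omega>\<bar> * W \<le> C * int p * W"
        using c(2) \<omega>(1,2) W by (auto simp: abs_mult intro!: mult_right_mono mult_mono)
      then have h: "?h \<in> affine_forms n (int N)"
        using affine_forms_mono[OF affine_forms_comb[OF g(1) f, of "c * \<omega>" "int p ^ j"]] N(1) p0 by simp
      (* The form ?h differs from p^j (c w + f) by c (p^j w - \<omega> g), of larger valuation. *)
      have "?v (int p ^ j * (c * w + f e)) = ?v (c * g e)"
        using eq by (simp only: scale_eq flip: vw)
      moreover have "?v (c * g e) < ?v (c * (int p ^ j * w - \<omega> * g e))"
        using close c(1) padic_val_mult_less_cancel[OF p, of "g e" c "int p ^ j * w - \<omega> * g e"]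
        by (simp add: g(2) Suc_ile_eq mult.commute)
      ultimately have "?v (int p ^ j * (c * w + f e) + - (c * (int p ^ j * w - \<omega> * g e))) = ?v (c * g e)"
        using padic_val_add_less[OF p, of "int p ^ j * (c * w + f e)"
            "- (c * (int p ^ j * w - \<omega> * g e))"] by (simp only: padic_val_minus)
      then have "?v (?h e) = ?v (c * g e)" by (simp add: algebra_simps)
      then have "?v (?h e') = ?v (c * g e')"
        using padic_sim_eq[OF sim h order_refl cg N(2)] by simp
      moreover have "?h e' = int p ^ j * (c * \<eta> + f e')"
      proof -
        have "?h e' = c * (\<omega> * g e') + int p ^ j * f e'" by simp
        then show ?thesis unfolding \<eta> by (simp add: algebra_simps)
      qed
      ultimately have "?v (int p ^ j * (c * \<eta> + f e')) = ?v (int p ^ j * (c * \<eta>))"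
        by (simp only: v\<eta>)
      then have "?v (c * \<eta> + f e') = ?v (c * \<eta>)"
        by (simp only: scale_eq)
      then show ?thesis using True by simp
    qed
    then show "(?v (c * w) < ?v (f e) \<longleftrightarrow> ?v (c * \<eta>) < ?v (f e')) \<and>
        (?v (f e) < ?v (c * w) \<longleftrightarrow> ?v (f e') < ?v (c * \<eta>)) \<and>
        (?v (c * w + f e) = min (?v (c * w)) (?v (f e)) \<longrightarrow>
          ?v (c * \<eta> + f e') = min (?v (c * \<eta>)) (?v (f e')))"
      using lt gt by blast
  qed (use assms \<open>\<eta> \<noteq> 0\<close> in auto)
  then show ?thesis using \<open>\<eta> \<noteq> 0\<close> by blast
qed

text \<open>
  Here no form has a valuation within distance \<open>J\<close> of \<open>v(w)\<close>, where \<open>J\<close> bounds the valuations of the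
  coefficients. If \<open>g\<close> has the largest valuation below \<open>v(w)\<close>, then \<open>v(w)\<close> lies in a gap of length
  more than \<open>2J + 1\<close> above \<open>v(g)\<close>. The gap is visible in \<open>e'\<close> by comparing \<open>p^(2J+1) g\<close> with the
  other forms, and \<open>\<eta> = p^(J+1) g(e')\<close> lies in its middle. Cancellation between \<open>c\<eta>\<close> and a form
  cannot occur, as their valuations differ.
\<close>

lemma padic_match_far:
  fixes B C :: int
  assumes p: "prime p" and sim: "padic_sim p n N e e'" and "1 \<le> B" "B \<le> int N"
    and w: "w \<noteq> 0" "padic_val p w = enat E"
    and far: "\<And>g j. g \<in> affine_forms n (int p ^ J * B) \<Longrightarrow> j \<le> J \<Longrightarrow> padic_val p (g e) \<noteq> enat (E + j)"
    and J: "C \<le> int J"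
    and N: "int p ^ (2 * J + 1) * B \<le> int N"
  shows "\<exists>\<eta>. \<eta> \<noteq> 0 \<and> padic_match p n C B e w e' \<eta>"
proof -
  let ?v = "padic_val p"
  have p1: "1 \<le> int p ^ j" for j using prime_gt_0_nat[OF p] by simp
  have scaled: "(\<lambda>e. int p ^ i * f e) \<in> affine_forms n (int p ^ j * B)"
    if "f \<in> affine_forms n B" "i \<le> j" for f i j
  proof -
    have "int p ^ i * B \<le> int p ^ j * B"
      using that(2) p1[of 1] \<open>1 \<le> B\<close> by (intro mult_right_mono power_increasing) auto
    then show ?thesis
      using affine_forms_mono[OF affine_forms_scale[OF that(1), of "int p ^ i"]] by simp
  qed
  have far': "?v (f e) \<noteq> enat (E + j)" if "f \<in> affine_forms n B" "j \<le> J" for f j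
    using far[OF scaled[OF that(1), of 0 J] that(2)] by simp
  let ?P = "\<lambda>f. f \<in> affine_forms n B \<and> ?v (f e) < enat E"
  have one: "(\<lambda>_. 1) \<in> affine_forms n B" using \<open>1 \<le> B\<close> by (intro affine_forms_const) simp
  have v1: "?v 1 = 0" using padic_val_power[OF p, of 0] by (simp add: zero_enat_def)
  have "?P (\<lambda>_. 1)" using one far'[OF one, of 0] v1 by (cases E) (auto simp: zero_enat_def)
  moreover have "\<forall>f. ?P f \<longrightarrow> the_enat (?v (f e)) < E"
    by (metis enat_ord_simps(2) enat_ord_simps(4) less_trans less_infinityE the_enat.simps)
  ultimately obtain g where "?P g" and max: "\<And>f. ?P f \<Longrightarrow> the_enat (?v (f e)) \<le> the_enat (?v (g e))"
    using ex_has_greatest_nat[of ?P "\<lambda>_. 1" "\<lambda>f. the_enat (?v (f e))" E] by blast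
  then have g: "g \<in> affine_forms n B" by blast
  obtain l where l: "?v (g e) = enat l" "l < E" using \<open>?P g\<close> by (cases "?v (g e)") auto
  have maxl: "?v (f e) \<le> ?v (g e)" if "f \<in> affine_forms n B" "?v (f e) < enat E" for f
    using max[of f] that l by (cases "?v (f e)") auto
  (* Otherwise a multiple of g by a power of p would have valuation E. *)
  have gap: "l + J < E"
  proof (rule ccontr)
    assume "\<not> l + J < E"
    then have "?v (int p ^ (E - l) * g e) = enat E" "E - l \<le> J"
      using l by (auto simp: padic_val_mult[OF p] padic_val_power[OF p])
    then show False using far[OF scaled[OF g, of "E - l" J], of 0] by simp
  qed
  have "g e' \<noteq> 0" using padic_sim_eq_0[OF sim g \<open>B \<le> int N\<close>] l by auto
  define \<eta> where "\<eta> = int p ^ Suc J * g e'"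
  have "\<eta> \<noteq> 0" using \<open>g e' \<noteq> 0\<close> prime_gt_0_nat[OF p] by (simp add: \<eta>_def)
  have v\<eta>: "?v \<eta> = enat (Suc J) + ?v (g e')"
    by (simp add: \<eta>_def padic_val_mult[OF p] padic_val_power[OF p] del: power_Suc)
  obtain l' where l': "?v (g e') = enat l'" using \<open>g e' \<noteq> 0\<close> by (cases "?v (g e')") auto
  have "padic_match p n C B e w e' \<eta>"
  proof (rule padic_matchI[OF sim])
    fix c f assume c: "c \<noteq> 0" "\<bar>c\<bar> \<le> C" and f: "f \<in> affine_forms n B"
    have "?v c < enat J" using padic_val_less[OF p c(1), of J] c(2) J by linarith
    then obtain k where k: "?v c = enat k" "k < J" by (cases "?v c") auto
    have "(?v (c * w) < ?v (f e) \<and> ?v (c * \<eta>) < ?v (f e')) \<or>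
      (?v (f e) < ?v (c * w) \<and> ?v (f e') < ?v (c * \<eta>))"
    proof (cases "?v (f e) < enat E")
      case True
      then have "\<not> ?v (g e) < ?v (f e)" using maxl[OF f] by simp
      then have "?v (f e') \<le> ?v (g e')"
        using padic_sim_less[OF sim g \<open>B \<le> int N\<close> f \<open>B \<le> int N\<close>] by simp
      then show ?thesis using True k l'
        by (cases "?v (f e)"; cases "?v (f e')") (auto simp: padic_val_mult[OF p] v\<eta> w)
    next
      case False
      have Ef: "enat (E + J) < ?v (f e)"
      proof (rule ccontr)
        assume "\<not> ?thesis"
        then obtain m where m: "?v (f e) = enat m" "m \<le> E + J" "E \<le> m"
          using False by (cases "?v (f e)") auto
        then have "m - E \<le> J" "E + (m - E) = m" by linarith+
        then show False using far'[OF f, of "m - E"] m(1) by simp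
      qed
      have "?v (int p ^ (2 * J + 1) * g e) < ?v (f e)"
        using Ef gap by (cases "?v (f e)") (auto simp: padic_val_mult[OF p] padic_val_power[OF p] l simp del: power_Suc)
      then have "?v (int p ^ (2 * J + 1) * g e') < ?v (f e')"
        using padic_sim_less[OF sim scaled[OF g order_refl, of "2 * J + 1"] N f \<open>B \<le> int N\<close>] by simp
      then have "enat (2 * J + 1 + l') < ?v (f e')"
        by (simp add: padic_val_mult[OF p] padic_val_power[OF p] l' del: power_Suc power_add)
      then show ?thesis using Ef k l'
        by (cases "?v (f e)"; cases "?v (f e')") (auto simp: padic_val_mult[OF p] v\<eta> w)
    qed
    then show "(?v (c * w) < ?v (f e) \<longleftrightarrow> ?v (c * \<eta>) < ?v (f e')) \<and>
        (?v (f e) < ?v (c * w) \<longleftrightarrow> ?v (f e') < ?v (c * \<eta>)) \<and>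
        (?v (c * w + f e) = min (?v (c * w)) (?v (f e)) \<longrightarrow>
          ?v (c * \<eta> + f e') = min (?v (c * \<eta>)) (?v (f e')))"
      using padic_val_add_neq[OF p, of "c * \<eta>" "f e'"] by auto
  qed (use assms \<open>\<eta> \<noteq> 0\<close> in auto)
  then show ?thesis using \<open>\<eta> \<noteq> 0\<close> by blast
qed

text \<open>
  The near and the far case exhaust all possibilities, and a single level suffices for both.
\<close>

lemma padic_match_exists:
  fixes B C :: int
  assumes p: "prime p" and B: "1 \<le> B" and C: "1 \<le> C"
  shows "\<exists>N. \<forall>e e' w. padic_sim p n N e e' \<longrightarrow> w \<noteq> 0 \<longrightarrow>
    (\<exists>\<eta>. \<eta> \<noteq> 0 \<and> padic_match p n C B e w e' \<eta>)"
proof -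
  define J where "J = nat C"
  define W where "W = int p ^ J * B"
  define N where "N = nat (C * int p * W + W + int p ^ (2 * J + 1) * B + C * W + B)"
  have p1: "1 \<le> int p" using prime_gt_0_nat[OF p] by simp
  have nonneg: "0 \<le> C * int p * W" "0 \<le> W" "0 \<le> int p ^ (2 * J + 1) * B" "0 \<le> C * W"
    using B C p1 unfolding W_def by (auto intro!: mult_nonneg_nonneg)
  have N: "int N = C * int p * W + W + int p ^ (2 * J + 1) * B + C * W + B"
    unfolding N_def using nonneg B by linarith
  have "\<exists>\<eta>. \<eta> \<noteq> 0 \<and> padic_match p n C B e w e' \<eta>" if sim: "padic_sim p n N e e'" and w: "w \<noteq> 0" for e e' w
  proof -
    obtain E where E: "padic_val p w = enat E" using w by (cases "padic_val p w") auto
    have BN: "B \<le> int N" using N nonneg B by linarith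
    show ?thesis
    proof (cases "\<exists>g j. g \<in> affine_forms n W \<and> j \<le> J \<and> padic_val p (g e) = enat (E + j)")
      case True
      then obtain g j where g: "g \<in> affine_forms n W" "j \<le> J" "padic_val p (g e) = enat (E + j)" by blast
      have "int p ^ j * B \<le> W"
        using g(2) p1 B unfolding W_def by (intro mult_right_mono power_increasing) auto
      then have "C * int p * W + int p ^ j * B \<le> int N" "C * W \<le> int N"
        using N nonneg B by linarith+
      then show ?thesis by (rule padic_match_near[OF p sim B C BN w E g(1,3)])
    next
      case False
      show ?thesis
      proof (rule padic_match_far[OF p sim B BN w E, of J])
        show "padic_val p (g e) \<noteq> enat (E + j)" if "g \<in> affine_forms n (int p ^ J * B)" "j \<le> J" for g j
          using False that unfolding W_def by blast
        show "C \<le> int J" by (simp add: J_def)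
        show "int p ^ (2 * J + 1) * B \<le> int N" using N nonneg B by linarith
      qed
    qed
  qed
  then show ?thesis by blast
qed

text \<open>
  If no cancellation occurs in \<open>cw + f\<close> and \<open>dw + g\<close>, their valuations are minima, and comparing
  minima reduces to the comparisons that similarity and matching preserve.
\<close>

lemma padic_match_less:
  fixes B C :: int
  assumes p: "prime p" and sim: "padic_sim p n N e e'" "B \<le> int N"
    and match: "padic_match p n C B e w e' w'"
    and w0: "w = 0 \<longleftrightarrow> w' = 0"
    and c: "\<bar>c\<bar> \<le> C" "\<bar>d\<bar> \<le> C" and fg: "f \<in> affine_forms n B" "g \<in> affine_forms n B"
    and min: "padic_val p (c * w + f e) = min (padic_val p (c * w)) (padic_val p (f e))"
      "padic_val p (d * w + g e) = min (padic_val p (d * w)) (padic_val p (g e))"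
  shows "padic_val p (c * w + f e) < padic_val p (d * w + g e) \<longleftrightarrow>
    padic_val p (c * w' + f e') < padic_val p (d * w' + g e')"
proof -
  let ?v = "padic_val p"
  have less_iff: "min a b < min a' b' \<longleftrightarrow> (a < a' \<or> b < a') \<and> (a < b' \<or> b < b')" for a b a' b' :: enat
    by (auto simp: min_less_iff_disj)
  have cf: "\<And>g. g \<in> affine_forms n B \<Longrightarrow> ?v (c * w) < ?v (g e) \<longleftrightarrow> ?v (c * w') < ?v (g e')"
    and dg: "\<And>f. f \<in> affine_forms n B \<Longrightarrow> ?v (f e) < ?v (d * w) \<longleftrightarrow> ?v (f e') < ?v (d * w')"
    and min': "?v (c * w' + f e') = min (?v (c * w')) (?v (f e'))"
      "?v (d * w' + g e') = min (?v (d * w')) (?v (g e'))"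
    using match c fg min unfolding padic_match_def by blast+
  have "?v (c * w) < ?v (d * w) \<longleftrightarrow> ?v (c * w') < ?v (d * w')"
    by (simp add: padic_val_mult_less_cancel[OF p] w0)
  then show ?thesis
    unfolding min min' less_iff
    using cf[OF fg(2)] dg[OF fg(1)] padic_sim_less[OF sim(1) fg(1) sim(2) fg(2) sim(2)] by simp
qed

text \<open>
  A nearest form exists because the forms with bounded coefficients take finitely many values at a
  given assignment.
\<close>

lemma padic_nearest_form:
  fixes T :: int
  assumes "0 \<le> T"
  obtains t where "t \<in> affine_forms n T"
    "\<And>f. f \<in> affine_forms n T \<Longrightarrow> padic_val p (x - f e) \<le> padic_val p (x - t e)"
proof -
  let ?V = "(\<lambda>y. padic_val p (x - y)) ` (\<lambda>f. f e) ` affine_forms n T"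
  let ?S = "T * (1 + (\<Sum>i<n. \<bar>e i\<bar>))"
  have "(\<lambda>f. f e) ` affine_forms n T \<subseteq> {- ?S..?S}"
    using affine_forms_bound[of _ n T e] by (fastforce simp: abs_le_iff)
  then have "finite ((\<lambda>f. f e) ` affine_forms n T)" by (rule finite_subset) simp
  then have fin: "finite ?V" by (rule finite_imageI)
  have "?V \<noteq> {}" using affine_forms_const[of 0 T n] assms by auto
  then obtain t where "t \<in> affine_forms n T" "Max ?V = padic_val p (x - t e)"
    using Max_in[OF fin] by auto
  then show thesis using that Max_ge[OF fin] by auto
qed

lemma int_crt:
  fixes m q a b :: int
  assumes "coprime m q"
  obtains x where "m dvd x - a" "q dvd x - b"
proof -
  have "gcd m q = 1" using assms by simp
  with bezout_int[of m q] obtain u v where uv: "u * m + v * q = 1" by auto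
  let ?x = "a * (v * q) + b * (u * m)"
  have "?x - a = (b - a) * u * m"
    using arg_cong[OF uv, of "\<lambda>y. a * y"] by (simp add: algebra_simps)
  moreover have "?x - b = (a - b) * v * q"
    using arg_cong[OF uv, of "\<lambda>y. b * y"] by (simp add: algebra_simps)
  ultimately show thesis using that[of ?x] by simp
qed

text \<open>
  The p-adic behaviour of \<open>w'\<close> and its residue modulo \<open>Q\<close> are independent by the Chinese remainder
  theorem, except when \<open>w = 0\<close>, which forces \<open>w' = 0\<close>.
\<close>

lemma padic_approximant:
  fixes B C :: int
  assumes p: "prime p" and B: "1 \<le> B" and C: "1 \<le> C" and Q: "0 < Q" "coprime Q (int p)"
  shows "\<exists>N. \<forall>e e' w z. padic_sim p n N e e' \<longrightarrow> (w = 0 \<longrightarrow> Q dvd z) \<longrightarrow>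
    (\<exists>w'. (w = 0 \<longleftrightarrow> w' = 0) \<and> Q dvd w' - z \<and> padic_match p n C B e w e' w')"
proof -
  obtain N where N: "\<And>e e' w. padic_sim p n N e e' \<Longrightarrow> w \<noteq> 0 \<Longrightarrow>
      \<exists>\<eta>. \<eta> \<noteq> 0 \<and> padic_match p n C B e w e' \<eta>"
    using padic_match_exists[OF p B C, of n] by blast
  have "\<exists>w'. (w = 0 \<longleftrightarrow> w' = 0) \<and> Q dvd w' - z \<and> padic_match p n C B e w e' w'"
    if sim: "padic_sim p n (max N (nat B)) e e'" and z: "w = 0 \<longrightarrow> Q dvd z" for e e' w z
  proof (cases "w = 0")
    case True
    then have "padic_match p n C B e w e' 0"
      by (intro padic_matchI[OF sim]) auto
    then show ?thesis using True z by (intro exI[of _ 0]) auto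
  next
    case False
    obtain \<eta> where \<eta>: "\<eta> \<noteq> 0" "padic_match p n C B e w e' \<eta>"
      using N[OF padic_sim_mono[OF sim] False] by auto
    obtain k where k: "padic_val p \<eta> = enat k" using \<eta>(1) by (cases "padic_val p \<eta>") auto
    have "coprime (int p ^ Suc k) Q"
      using Q(2) by (simp add: coprime_commute del: power_Suc)
    then obtain w' where w': "int p ^ Suc k dvd w' - \<eta>" "Q dvd w' - z"
      by (rule int_crt)
    have "padic_match p n C B e w e' w'"
      by (rule padic_match_close[OF p sim _ \<eta>(2) False k w'(1)]) auto
    moreover have "w' \<noteq> 0"
    proof
      assume "w' = 0"
      then have "int p ^ Suc k dvd \<eta>" using w'(1) by simp
      then show False unfolding power_dvd_iff_padic_val[OF p] k by simp
    qed
    ultimately show ?thesis using False w'(2) by blast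
  qed
  then show ?thesis by blast
qed

lemma padic_sim_dvd:
  assumes "padic_sim p n N e e'" "0 < m" "m \<le> int N" "coprime m (int p)" "i < n"
  shows "m dvd e i - e' i"
proof -
  have m: "int (nat m) = m" using assms(2) by simp
  then have "coprime (nat m) p" using assms(4) by (metis coprime_int_iff)
  moreover have "nat m \<in> {1..N}" using assms(2,3) by auto
  ultimately have "int (nat m) dvd e i - e' i"
    using assms(1,5) unfolding padic_sim_def by blast
  then show ?thesis by (simp only: m)
qed

text \<open>
  Why the nearest form is the right origin: with \<open>K = cd\<close>, the number \<open>cw + (c\<tau> + K g)\<close> is \<open>c\<close> times
  the difference of \<open>x\<close> and the form \<open>- d g\<close>, whose valuation cannot exceed \<open>v(w)\<close>. So no
  cancellation occurs.
\<close>

lemma padic_min_at_nearest: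
  assumes p: "prime p" and K: "K > 0" and N: "\<And>c. c \<noteq> 0 \<Longrightarrow> \<bar>c\<bar> \<le> C \<Longrightarrow> c dvd K"
    and nearest: "\<And>f. f \<in> affine_forms n (K * B) \<Longrightarrow> padic_val p (x - f e) \<le> padic_val p w"
    and w: "w = x - \<tau>" and c: "\<bar>c\<bar> \<le> C" and g: "g \<in> affine_forms n B" and "0 \<le> B"
  shows "padic_val p (c * w + (c * \<tau> + K * g e)) =
    min (padic_val p (c * w)) (padic_val p (c * \<tau> + K * g e))"
proof (cases "c = 0")
  case False
  let ?v = "padic_val p" and ?h = "c * \<tau> + K * g e"
  show ?thesis
  proof (cases "?v (c * w) = ?v ?h")
    case neq: False
    then show ?thesis by (rule padic_val_add_neq[OF p])
  next
    case True
    obtain d where d: "K = c * d" using N[OF False c] by blast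
    have "\<bar>- d\<bar> \<le> K"
    proof -
      have "1 \<le> \<bar>c\<bar>" using False by linarith
      then have "1 * \<bar>d\<bar> \<le> \<bar>c\<bar> * \<bar>d\<bar>" by (intro mult_right_mono) auto
      then show ?thesis using K by (simp add: d flip: abs_mult)
    qed
    then have "\<bar>- d\<bar> * B \<le> K * B" using \<open>0 \<le> B\<close> by (rule mult_right_mono)
    then have "?v (x - (- d) * g e) \<le> ?v w"
      by (intro nearest affine_forms_mono[OF affine_forms_scale[OF g, of "- d"]])
    then have "?v (c * (x - (- d) * g e)) \<le> ?v (c * w)"
      unfolding padic_val_mult[OF p] by (rule add_left_mono)
    moreover have "c * (x - (- d) * g e) = c * w + ?h"
      by (simp add: w d algebra_simps)
    ultimately have "?v (c * w + ?h) \<le> ?v (c * w)" by simp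
    then show ?thesis using padic_val_add_ge[OF p, of "c * w" ?h] True by simp
  qed
qed simp

text \<open>
  Write \<open>Ka = t + w\<close> with \<open>t\<close> the p-adically nearest form, find \<open>w'\<close> matching \<open>w\<close>, and let
  \<open>Kb = t(e') + w'\<close>. Divisibility of this number by the p-part of \<open>K\<close> follows from the matching, as
  the powers of \<open>p\<close> are themselves forms; divisibility by the part \<open>K'\<close> prime to \<open>p\<close>, and the
  congruence of \<open>a\<close> and \<open>b\<close> modulo \<open>K'\<close>, follow from a congruence modulo \<open>K'\<^sup>2\<close>.
\<close>

lemma padic_sim_forth:
  assumes p: "prime p"
  shows "\<exists>N'. \<forall>e e' i a. padic_sim p n N' e e' \<longrightarrow> i < n \<longrightarrow> (\<exists>b. padic_sim p n N (e(i := a)) (e'(i := b)))"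
proof -
  let ?v = "padic_val p"
  (* Suc N instead of N keeps the coefficient bound C positive when N = 0. *)
  define K where "K = int (fact (Suc N))"
  have K: "K > 0" by (simp add: K_def del: fact_Suc)
  have dvdK: "c dvd K" if "c \<noteq> 0" "\<bar>c\<bar> \<le> int (Suc N)" for c
  proof -
    have "nat \<bar>c\<bar> dvd fact (Suc N)" using that by (intro dvd_fact) auto
    then have "int (nat \<bar>c\<bar>) dvd K" unfolding K_def by (rule of_nat_dvd_iff[THEN iffD2])
    then show ?thesis by simp
  qed
  define C where "C = int (Suc N)"
  have C: "1 \<le> C" by (simp add: C_def)
  obtain r where r: "?v K = enat r" using K by (cases "?v K") auto
  obtain K' where K': "K = int p ^ r * K'" "\<not> int p dvd K'"
    using padic_unit_part[OF p r] .
  have K'0: "0 < K'"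
    using K K'(1) prime_gt_0_nat[OF p] by (simp add: zero_less_mult_iff)
  have K'p: "coprime K' (int p)"
    using prime_imp_coprime[of "int p" K'] p K'(2) by (simp add: coprime_commute)
  define Q where "Q = K' * K'"
  have Q: "0 < Q" "coprime Q (int p)" using K'0 K'p by (auto simp: Q_def)
  define B where "B = C * (K * C) + K * C"
  have "1 * 1 \<le> K * C" using K C by (intro mult_mono) auto
  moreover from this have "0 \<le> C * (K * C)" using C by simp
  ultimately have B: "1 \<le> B" "K * C \<le> B" by (auto simp: B_def)
  (* The constant p^r has to be one of the forms that the matching controls. *)
  have "int p ^ r * 1 \<le> K"
    unfolding K'(1) using K'0 by (intro mult_left_mono) auto
  moreover have "K * 1 \<le> K * C" using K C by (intro mult_left_mono) auto
  ultimately have prB: "int p ^ r \<le> B" using B by linarith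
  obtain N0 where N0: "\<And>e e' w z. padic_sim p n N0 e e' \<Longrightarrow> (w = 0 \<Longrightarrow> Q dvd z) \<Longrightarrow>
      \<exists>w'. (w = 0 \<longleftrightarrow> w' = 0) \<and> Q dvd w' - z \<and> padic_match p n C B e w e' w'"
    using padic_approximant[OF p B(1) C Q, of n] by blast
  define N' where "N' = N0 + nat B + nat Q + N"
  have "\<exists>b. padic_sim p n N (e(i := a)) (e'(i := b))" if sim: "padic_sim p n N' e e'" and i: "i < n" for e e' i a
  proof -
    have BN': "B \<le> int N'" and QN': "Q \<le> int N'" using B Q by (auto simp: N'_def)
    obtain t where t: "t \<in> affine_forms n (K * C)"
      and nearest: "\<And>f. f \<in> affine_forms n (K * C) \<Longrightarrow> ?v (K * a - f e) \<le> ?v (K * a - t e)"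
      using padic_nearest_form[of "K * C" n p "K * a" e] K C by auto
    define w where "w = K * a - t e"
    have min: "?v (c * w + (c * t e + K * g e)) = min (?v (c * w)) (?v (c * t e + K * g e))"
      if "\<bar>c\<bar> \<le> C" "g \<in> affine_forms n C" for c g
    proof (rule padic_min_at_nearest[where C = C and B = C and x = "K * a", OF p K _ _ w_def that])
      show "c dvd K" if "c \<noteq> 0" "\<bar>c\<bar> \<le> C" for c using dvdK that by (simp add: C_def)
      show "?v (K * a - f e) \<le> ?v w" if "f \<in> affine_forms n (K * C)" for f
        using nearest[OF that] by (simp add: w_def)
    qed (use C in simp)
    have form: "(\<lambda>e. c * t e + K * g e) \<in> affine_forms n B" if "\<bar>c\<bar> \<le> C" "g \<in> affine_forms n C" for c g
    proof -
      have "\<bar>c\<bar> * (K * C) \<le> C * (K * C)" using that(1) K C by (intro mult_right_mono) auto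
      then show ?thesis
        using affine_forms_mono[OF affine_forms_comb[OF t that(2), of c K]] K by (simp add: B_def)
    qed
    have "Q dvd t e - t e'"
      by (rule affine_forms_dvd_diff[OF t]) (rule padic_sim_dvd[OF sim Q(1) QN' Q(2)])
    then have "w = 0 \<Longrightarrow> Q dvd K * a - t e'" by (simp add: w_def)
    from N0[OF padic_sim_mono[OF sim] this] obtain w' where w0: "w = 0 \<longleftrightarrow> w' = 0"
      and Qw': "Q dvd w' - (K * a - t e')" and match: "padic_match p n C B e w e' w'"
      by (auto simp: N'_def)
    have pr: "enat r \<le> ?v (t e' + w')"
    proof -
      have "K dvd w + t e" by (simp add: w_def)
      then have "int p ^ r dvd w + t e" using K'(1) by (metis dvd_mult_left)
      then have "enat r \<le> min (?v w) (?v (t e))"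
        using min[of 1 "\<lambda>_. 0"] C affine_forms_const[of 0 C n]
        by (simp add: power_dvd_iff_padic_val[OF p])
      then have "\<not> ?v (1 * w) < ?v (int p ^ r)" "\<not> ?v (t e) < ?v (int p ^ r)"
        by (auto simp: padic_val_power[OF p])
      moreover have const: "(\<lambda>_. int p ^ r) \<in> affine_forms n B"
        using prB by (intro affine_forms_const) simp
      ultimately have "\<not> ?v (1 * w') < ?v (int p ^ r)" "\<not> ?v (t e') < ?v (int p ^ r)"
        using match[unfolded padic_match_def, rule_format, of 1 "\<lambda>_. int p ^ r"] C
          padic_sim_less[OF sim t _ const BN'] B BN'
        by auto
      then show ?thesis
        using padic_val_add_ge[OF p, of "t e'" w']
        by (auto simp: padic_val_power[OF p] min_def split: if_splits)
    qed
    have Qb: "Q dvd (t e' + w') - K * a" using Qw' by (simp add: algebra_simps)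
    then have "K' dvd (t e' + w') - K * a" unfolding Q_def by (rule dvd_mult_left)
    moreover have "K' dvd K * a" by (simp add: K'(1))
    ultimately have "K' dvd t e' + w'" by (metis dvd_diff_left_iff)
    moreover have "int p ^ r dvd t e' + w'" using pr by (simp add: power_dvd_iff_padic_val[OF p])
    moreover have cop: "coprime (int p ^ r) K'" using K'p by (simp add: coprime_commute)
    ultimately have "K dvd t e' + w'" unfolding K'(1) by (intro divides_mult)
    then obtain b where b: "t e' + w' = K * b" by blast
    have "K' * K' dvd K' * (int p ^ r * (b - a))"
      using Qb unfolding b Q_def by (simp add: K'(1) algebra_simps)
    then have "K' dvd int p ^ r * (b - a)" using K'0 by simp
    then have K'ab: "K' dvd a - b"
      using cop by (metis coprime_commute coprime_dvd_mult_right_iff dvd_diff_commute)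
    have "padic_less p (f (e(i := a))) (g (e(i := a))) \<longleftrightarrow> padic_less p (f (e'(i := b))) (g (e'(i := b)))"
      if fg_in: "f \<in> affine_forms n (int N)" "g \<in> affine_forms n (int N)" for f g
    proof -
      obtain c f' where f: "\<bar>c\<bar> \<le> int N" "f' \<in> affine_forms n (int N)"
        "\<And>e a. f (e(i := a)) = c * a + f' e"
        using affine_forms_update[OF fg_in(1) i] by blast
      obtain d g' where g: "\<bar>d\<bar> \<le> int N" "g' \<in> affine_forms n (int N)"
        "\<And>e a. g (e(i := a)) = d * a + g' e"
        using affine_forms_update[OF fg_in(2) i] by blast
      have cd: "\<bar>c\<bar> \<le> C" "\<bar>d\<bar> \<le> C" and fg': "f' \<in> affine_forms n C" "g' \<in> affine_forms n C"
        using f g affine_forms_mono by (auto simp: C_def)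
      have K_less: "?v x < ?v y \<longleftrightarrow> ?v (K * x) < ?v (K * y)" for x y
        using padic_val_mult_less_cancel[OF p, of x K y] K by (simp add: mult.commute)
      have Ka: "K * (x * a + y) = x * w + (x * t e + K * y)" for x y
        by (simp add: w_def algebra_simps)
      have Kb: "K * (x * b + y) = x * w' + (x * t e' + K * y)" for x y
        using arg_cong[OF b, of "\<lambda>z. x * z"] by (simp add: algebra_simps)
      show ?thesis
        using padic_match_less[OF p sim BN' match w0 cd form[OF cd(1) fg'(1)] form[OF cd(2) fg'(2)]
            min[OF cd(1) fg'(1)] min[OF cd(2) fg'(2)]]
        unfolding Ka[symmetric] Kb[symmetric] K_less[symmetric] padic_less_def f(3) g(3) .
    qed
    moreover have "int m dvd (e(i := a)) j - (e'(i := b)) j"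
      if m: "m \<in> {1..N}" "coprime m p" and j: "j < n" for m j
    proof (cases "j = i")
      case True
      have "int m dvd int p ^ r * K'" using dvdK[of "int m"] m(1) by (simp add: K'(1))
      moreover have "coprime (int m) (int p ^ r)" using m(2) by simp
      ultimately have "int m dvd K'" by (simp add: coprime_dvd_mult_right_iff)
      then show ?thesis using True K'ab by (auto intro: dvd_trans)
    next
      case False
      then show ?thesis using padic_sim_dvd[OF sim, of "int m" j] m j by (simp add: N'_def)
    qed
    ultimately show ?thesis unfolding padic_sim_def by blast
  qed
  then show ?thesis by blast
qed

lemma padic_sim_sat:
  assumes p: "prime p" and \<phi>: "wf_fm (int_plus_padic p) \<phi>" "fm_vars \<phi> \<subseteq> {..<n}"
  shows "\<exists>N. \<forall>e e'. padic_sim p n N e e' \<longrightarrow>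
    (sat (int_plus_padic p) e \<phi> \<longleftrightarrow> sat (int_plus_padic p) e' \<phi>)"
proof (rule additive_back_and_forth_sat[where R = "padic_sim p n", OF int_plus_padic_def
      padic_sim_sym padic_sim_mono padic_sim_forth[OF p] _ _ \<phi>])
  fix f g B B' assume f: "f \<in> affine_forms n B" and g: "g \<in> affine_forms n B'"
  have "padic_less p (f e) (g e) \<longleftrightarrow> padic_less p (f e') (g e')"
    if "padic_sim p n (nat (max B B')) e e'" for e e'
    unfolding padic_less_def by (rule padic_sim_less[OF that f _ g]) linarith+
  then show "\<exists>N. \<forall>e e'. padic_sim p n N e e' \<longrightarrow> (padic_less p (f e) (g e) \<longleftrightarrow> padic_less p (f e') (g e'))"
    by blast
  have diff: "(\<lambda>e. f e - g e) \<in> affine_forms n (B + B')"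
    using affine_forms_comb[OF f g, of 1 "- 1"] by simp
  have "f e = g e \<longleftrightarrow> f e' = g e'" if "padic_sim p n (nat (B + B')) e e'" for e e'
    using padic_sim_eq_0[OF that diff] by simp
  then show "\<exists>N. \<forall>e e'. padic_sim p n N e e' \<longrightarrow> (f e = g e \<longleftrightarrow> f e' = g e')"
    by blast
qed

section \<open>Local periodicity of definable sets of integers\<close>

lemma definable_unaryE:
  assumes "definable M 1 X"
  obtains \<phi> e n where "wf_fm M \<phi>" "fm_vars \<phi> \<subseteq> {..<n}" "0 < n"
    "\<And>k. [k] \<in> X \<longleftrightarrow> sat M (e(0 := k)) \<phi>"
proof -
  obtain \<phi> e where \<phi>: "wf_fm M \<phi>"
    and X: "X = {xs. length xs = 1 \<and> sat M (\<lambda>i. if i < 1 then xs ! i else e i) \<phi>}"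
    using assms unfolding definable_def by blast
  have upd: "(\<lambda>i. if i < 1 then [k] ! i else e i) = e(0 := k)" for k by auto
  have mem: "[k] \<in> X \<longleftrightarrow> sat M (e(0 := k)) \<phi>" for k
    unfolding X upd[symmetric] by simp
  have "fm_vars \<phi> \<subseteq> {..<Suc (Max (insert 0 (fm_vars \<phi>)))}"
    using finite_fm_vars[of \<phi>] by (auto simp: less_Suc_eq_le)
  with that[OF \<phi> this _ mem] show thesis by simp
qed

lemma affine_forms_at_large:
  assumes f: "f \<in> affine_forms n B" and n: "0 < n" and k: "k > B * (1 + (\<Sum>i<n. \<bar>e i\<bar>))"
  obtains c d where "\<bar>c\<bar> \<le> B" "\<bar>d\<bar> < k" "\<And>x. f (e(0 := x)) = c * x + d"
proof -
  obtain c g where "\<bar>c\<bar> \<le> B" "g \<in> affine_forms n B" "\<And>e a. f (e(0 := a)) = c * a + g e"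
    using affine_forms_update[OF f n] by blast
  with affine_forms_bound[of g n B e] k that[of c "g e"] show thesis by force
qed

text \<open>
  For \<open>k\<close> beyond the bound, the sign of \<open>cx + d\<close> at \<open>x \<ge> k\<close> depends only on the signs of \<open>c\<close> and,
  if \<open>c = 0\<close>, of \<open>d\<close>; so \<open>k\<close> and \<open>k + Dq\<close> are similar if \<open>D\<close> is divisible by all small moduli.
\<close>

lemma definable_less_locally_periodic:
  assumes "definable int_plus_less 1 X"
  shows "\<exists>S. \<forall>k>S. \<exists>D>0. \<forall>q::nat. [k] \<in> X \<longleftrightarrow> [k + D * int q] \<in> X"
proof -
  obtain \<phi> e n where \<phi>: "wf_fm int_plus_less \<phi>" "fm_vars \<phi> \<subseteq> {..<n}" and n: "0 < n"
    and X: "\<And>k. [k] \<in> X \<longleftrightarrow> sat int_plus_less (e(0 := k)) \<phi>"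
    by (rule definable_unaryE[OF assms]) (rule that)
  obtain N where N: "\<And>e e'. order_sim n N e e' \<Longrightarrow> sat int_plus_less e \<phi> \<longleftrightarrow> sat int_plus_less e' \<phi>"
    using order_sim_sat[OF \<phi>] by blast
  define D where "D = int (fact N)"
  have D: "D > 0" by (simp add: D_def)
  have "order_sim n N (e(0 := k)) (e(0 := k + D * int q))"
    if k: "k > int N * (1 + (\<Sum>i<n. \<bar>e i\<bar>))" for k and q :: nat
    unfolding order_sim_def
  proof (intro conjI ballI allI impI)
    fix f assume "f \<in> affine_forms n (int N)"
    then obtain c d where d: "\<bar>d\<bar> < k" and f: "\<And>x. f (e(0 := x)) = c * x + d"
      using affine_forms_at_large[OF _ n k] by blast
    have sign: "0 < c * x + d \<longleftrightarrow> 0 < c \<or> c = 0 \<and> 0 < d" if "x \<ge> k" for x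
    proof -
      have "x \<le> c * x" if "0 < c" using that \<open>x \<ge> k\<close> d mult_right_mono[of 1 c x] by simp
      moreover have "c * x \<le> - x" if "c < 0" using that \<open>x \<ge> k\<close> d mult_right_mono[of c "- 1" x] by simp
      ultimately show ?thesis using d that by (cases c "0 :: int" rule: linorder_cases) auto
    qed
    show "0 < f (e(0 := k)) \<longleftrightarrow> 0 < f (e(0 := k + D * int q))"
      unfolding f using sign[of k] sign[of "k + D * int q"] D by simp
  next
    fix m i assume "m \<in> {1..N}"
    then have "int m dvd D" unfolding D_def int_dvd_int_iff by (intro dvd_fact) auto
    then show "int m dvd (e(0 := k)) i - (e(0 := k + D * int q)) i" by simp
  qed
  from N[OF this, folded X] D show ?thesis by blast
qed

text \<open>
  The bound on \<open>k\<close> excludes zeros of \<open>cx + d\<close> with \<open>c \<noteq> 0\<close> at \<open>k\<close>. Hence these numbers have valuation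
  less than some \<open>R\<close> that depends on \<open>k\<close>, and a shift by a multiple of \<open>p\<^sup>R\<close> preserves all of their valuations.
\<close>

lemma definable_padic_locally_periodic:
  assumes p: "prime p" and "definable (int_plus_padic p) 1 X"
  shows "\<exists>S. \<forall>k>S. \<exists>D>0. \<forall>q::nat. [k] \<in> X \<longleftrightarrow> [k + D * int q] \<in> X"
proof -
  let ?v = "padic_val p"
  obtain \<phi> e n where \<phi>: "wf_fm (int_plus_padic p) \<phi>" "fm_vars \<phi> \<subseteq> {..<n}" and n: "0 < n"
    and X: "\<And>k. [k] \<in> X \<longleftrightarrow> sat (int_plus_padic p) (e(0 := k)) \<phi>"
    by (rule definable_unaryE[OF assms(2)]) (rule that)
  obtain N where N: "\<And>e e'. padic_sim p n N e e' \<Longrightarrow>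
      sat (int_plus_padic p) e \<phi> \<longleftrightarrow> sat (int_plus_padic p) e' \<phi>"
    using padic_sim_sat[OF p \<phi>] by blast
  have "\<exists>D>0. \<forall>q::nat. [k] \<in> X \<longleftrightarrow> [k + D * int q] \<in> X"
    if k: "k > int N * (1 + (\<Sum>i<n. \<bar>e i\<bar>))" for k
  proof -
    define R where "R = nat (int N * k + k)"
    define D where "D = int (fact N) * int p ^ R"
    have D: "D > 0" using prime_gt_0_nat[OF p] by (simp add: D_def)
    have "0 \<le> int N * (1 + (\<Sum>i<n. \<bar>e i\<bar>))" by (simp add: sum_nonneg)
    then have "0 < k" using k by linarith
    have "padic_sim p n N (e(0 := k)) (e(0 := k + D * int q))" for q :: nat
      unfolding padic_sim_def padic_less_def
    proof (intro conjI ballI allI impI)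
      have val: "?v (f (e(0 := k + D * int q))) = ?v (f (e(0 := k)))"
        if f_in: "f \<in> affine_forms n (int N)" for f
      proof -
        obtain c d where c: "\<bar>c\<bar> \<le> int N" and d: "\<bar>d\<bar> < k" and f: "\<And>x. f (e(0 := x)) = c * x + d"
          using affine_forms_at_large[OF f_in n k] by blast
        show ?thesis
        proof (cases "c = 0")
          case False
          have "1 * k \<le> \<bar>c\<bar> * k" using False \<open>0 < k\<close> by (intro mult_right_mono) auto
          then have "c * k + d \<noteq> 0" using d \<open>0 < k\<close> by (auto simp: abs_mult add_eq_0_iff)
          moreover have "\<bar>c * k + d\<bar> \<le> int R"
          proof -
            have "\<bar>c\<bar> * k \<le> int N * k" using c \<open>0 < k\<close> by (intro mult_right_mono) auto
            moreover have "\<bar>c * k\<bar> = \<bar>c\<bar> * k" using \<open>0 < k\<close> by (simp add: abs_mult)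
            ultimately show ?thesis using abs_triangle_ineq[of "c * k" d] d unfolding R_def by linarith
          qed
          ultimately have "?v (c * k + d) < enat R" by (rule padic_val_less[OF p])
          also have "enat R \<le> ?v (c * (D * int q))"
            unfolding power_dvd_iff_padic_val[OF p, symmetric] by (simp add: D_def)
          finally have "?v ((c * k + d) + c * (D * int q)) = ?v (c * k + d)"
            by (rule padic_val_add_less[OF p])
          then show ?thesis by (simp add: f algebra_simps)
        qed (simp add: f)
      qed
      show "?v (f (e(0 := k))) < ?v (g (e(0 := k))) \<longleftrightarrow>
          ?v (f (e(0 := k + D * int q))) < ?v (g (e(0 := k + D * int q)))"
        if "f \<in> affine_forms n (int N)" "g \<in> affine_forms n (int N)" for f g
        by (simp only: val that)
    next
      fix m i assume "m \<in> {1..N}"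
      then have "int m dvd int (fact N)" unfolding int_dvd_int_iff by (intro dvd_fact) auto
      then have "int m dvd D" unfolding D_def by (rule dvd_mult2)
      then show "int m dvd (e(0 := k)) i - (e(0 := k + D * int q)) i" by simp
    qed
    from N[OF this, folded X] D show ?thesis by blast
  qed
  then show ?thesis by blast
qed

section \<open>The arc of the cyclic order\<close>

lemma coset_Ints_eq_iff:
  fixes x a :: real
  assumes "a \<in> {0..<1}"
  shows "x +o \<int> = a +o \<int> \<longleftrightarrow> a = frac x"
proof
  assume "x +o \<int> = a +o \<int>"
  moreover have "x \<in> x +o \<int>" by (auto simp: elt_set_plus_def intro!: bexI[of _ 0])
  ultimately have "x - a \<in> \<int>" by (auto simp: elt_set_plus_def)
  then show "a = frac x" using assms frac_unique_iff[of x a] by simp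
next
  assume "a = frac x"
  then have x: "x = a + of_int \<lfloor>x\<rfloor>" by (simp add: frac_def)
  show "x +o \<int> = a +o \<int>"
  proof (intro set_eqI iffI)
    fix y assume "y \<in> x +o \<int>"
    then obtain z where "z \<in> \<int>" "y = a + (of_int \<lfloor>x\<rfloor> + z)"
      using x by (auto simp: elt_set_plus_def)
    then show "y \<in> a +o \<int>" by (auto simp: elt_set_plus_def)
  next
    fix y assume "y \<in> a +o \<int>"
    then obtain z where "z \<in> \<int>" "y = x + (z - of_int \<lfloor>x\<rfloor>)"
      using x by (auto simp: elt_set_plus_def)
    then show "y \<in> x +o \<int>"
      by (auto simp: elt_set_plus_def intro!: bexI[of _ "z - of_int \<lfloor>x\<rfloor>"])
  qed
qed

lemma cyclic_order_0_1_iff: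
  "cyclic_order \<alpha> 0 k 1 \<longleftrightarrow> 0 < frac (\<alpha> * of_int k) \<and> frac (\<alpha> * of_int k) < frac \<alpha>"
proof -
  have "cyclic_order \<alpha> 0 k 1 \<longleftrightarrow>
    (\<exists>a\<in>{0..<1}. \<exists>b\<in>{0..<1}. \<exists>c\<in>{0..<1}. a = frac (\<alpha> * of_int 0) \<and> b = frac (\<alpha> * of_int k) \<and>
      c = frac (\<alpha> * of_int 1) \<and> (a < b \<and> b < c \<or> b < c \<and> c < a \<or> c < a \<and> a < b))"
    unfolding cyclic_order_def circle_order_def
    by (intro bex_cong refl) (simp only: coset_Ints_eq_iff)
  also have "\<dots> \<longleftrightarrow> 0 < frac (\<alpha> * of_int k) \<and> frac (\<alpha> * of_int k) < frac \<alpha>"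
    by (auto simp: frac_lt_1 not_less[THEN iffD2, OF frac_ge_0])
  finally show ?thesis .
qed

lemma definable_arc: "definable (int_plus_cyc \<alpha>) 1 {[k] | k. cyclic_order \<alpha> 0 k 1}"
  unfolding definable_def
  (* The parameters are 0 at index 1 and 1 at index 2. *)
  by (intro exI[of _ "Rel Cyc [Var 1, Var 0, Var 2]"] exI[of _ "\<lambda>i. if i = 1 then 0 else 1"])
     (auto simp: int_plus_cyc_def length_Suc_conv)

text \<open>
  Kronecker's theorem for an arithmetic progression with arbitrary start \<open>\<beta>\<close>. The approximated point
  lies in the interior of the unit interval, so that being close to it modulo the integers means
  having a close fractional part.
\<close>

lemma frac_progression_dense:
  fixes \<theta> \<beta> u v :: real
  assumes "\<theta> \<notin> \<rat>" "0 \<le> u" "u < v" "v \<le> 1"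
  obtains q :: nat where "u < frac (\<beta> + real q * \<theta>)" "frac (\<beta> + real q * \<theta>) < v"
proof -
  have half_pos: "0 < (v - u) / 2" using assms(3) by simp
  obtain k h :: int where k: "k > 0" "\<bar>of_int k * \<theta> - of_int h - ((u + v) / 2 - \<beta>)\<bar> < (v - u) / 2"
    using sequence_of_fractional_parts_is_dense[OF assms(1) half_pos, of "(u + v) / 2 - \<beta>"] .
  define q where "q = nat k"
  let ?y = "\<beta> + real q * \<theta> - of_int h"
  have "u < ?y" "?y < v"
    using k by (auto simp: q_def abs_less_iff field_simps)
  moreover from this have "frac (\<beta> + real q * \<theta>) = ?y"
    using assms(2,4) by (simp add: frac_unique_iff)
  ultimately show thesis using that[of q] by simp
qed

lemma arc_not_locally_periodic:
  assumes \<alpha>: "\<alpha> \<notin> \<rat>"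
  shows "\<not> (\<exists>S. \<forall>k>S. \<exists>D>0. \<forall>q::nat. cyclic_order \<alpha> 0 k 1 \<longleftrightarrow> cyclic_order \<alpha> 0 (k + D * int q) 1)"
proof
  assume "\<exists>S. \<forall>k>S. \<exists>D>0. \<forall>q::nat. cyclic_order \<alpha> 0 k 1 \<longleftrightarrow> cyclic_order \<alpha> 0 (k + D * int q) 1"
  then obtain S where S: "\<And>k. k > S \<Longrightarrow>
      \<exists>D>0. \<forall>q::nat. cyclic_order \<alpha> 0 k 1 \<longleftrightarrow> cyclic_order \<alpha> 0 (k + D * int q) 1"
    by blast
  have "frac \<alpha> \<noteq> 0" using \<alpha> Ints_subset_Rats by (auto simp: frac_eq_0_iff)
  then have frac_\<alpha>: "0 < frac \<alpha>" "frac \<alpha> < 1" using frac_ge_0[of \<alpha>] frac_lt_1[of \<alpha>] by linarith+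
  obtain j :: nat where j: "0 < frac (\<alpha> * of_int (S + 1) + real j * \<alpha>)"
    "frac (\<alpha> * of_int (S + 1) + real j * \<alpha>) < frac \<alpha>"
    using frac_progression_dense[OF \<alpha>, of 0 "frac \<alpha>"] frac_\<alpha> by auto
  define k where "k = S + 1 + int j"
  have "cyclic_order \<alpha> 0 k 1"
    using j unfolding cyclic_order_0_1_iff k_def by (simp add: algebra_simps)
  then obtain D where D: "D > 0" and periodic: "\<And>q::nat. cyclic_order \<alpha> 0 (k + D * int q) 1"
    using S[of k] by (auto simp: k_def)
  have "\<alpha> * of_int D \<notin> \<rat>"
  proof
    assume "\<alpha> * of_int D \<in> \<rat>"
    then have "\<alpha> * of_int D / of_int D \<in> \<rat>" by (intro Rats_divide) auto
    then show False using \<alpha> D by simp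
  qed
  then obtain q :: nat where q: "frac \<alpha> < frac (\<alpha> * of_int k + real q * (\<alpha> * of_int D))"
    using frac_progression_dense[of "\<alpha> * of_int D" "frac \<alpha>" 1] frac_\<alpha> by auto
  with periodic[of q] show False
    unfolding cyclic_order_0_1_iff by (simp add: algebra_simps)
qed

theorem theorem2p6:
  fixes \<alpha> :: real
  assumes "\<alpha> \<notin> \<rat>"
  shows "\<not> is_reduct_of (int_plus_cyc \<alpha>) int_plus_less \<and>
         (\<forall>p::nat. prime p \<longrightarrow> \<not> is_reduct_of (int_plus_cyc \<alpha>) (int_plus_padic p))"
proof -
  let ?X = "{[k] | k. cyclic_order \<alpha> 0 k 1}"
  have mem: "[k] \<in> ?X \<longleftrightarrow> cyclic_order \<alpha> 0 k 1" for k by simp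
  have "\<not> definable int_plus_less 1 ?X"
    using definable_less_locally_periodic[of ?X] arc_not_locally_periodic[OF assms]
    unfolding mem by blast
  moreover have "\<not> definable (int_plus_padic p) 1 ?X" if "prime p" for p
    using definable_padic_locally_periodic[OF that, of ?X] arc_not_locally_periodic[OF assms]
    unfolding mem by blast
  ultimately show ?thesis
    using definable_arc[of \<alpha>] unfolding is_reduct_of_def by blast
qed

end
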